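(* Let $J$ be a conjugation on a complex Hilbert space $H$. Let $A$ be a closed $J$-imaginary symmetric operator in $H$ with $\overline{D(A)}=H$. Then there exist a Hilbert space $\widetilde H\supseteq H$, a conjugation $\widetilde J$ on $\widetilde H$ extending $J$ (that is, $\widetilde J h = Jh$ for all $h\in H$), and a $\widetilde J$-imaginary self-adjoint operator $\widetilde A$ in $\widetilde H$ such that $\widetilde A\supseteq A$. Moreover, if the defect numbers of $A$ are equal, then there exists a $J$-imaginary self-adjoint operator $\widehat A\supseteq A$ in $H$.
   Context: Linear operators $A$ in a Hilbert space $H$ are defined on a linear subspace $D(A)\subseteq H$ (the domain) and may be unbounded. $\widetilde A\supseteq A$ means that $D(A)\subseteq D(\widetilde A)$ and $\widetilde A f=Af$ for $f\in D(A)$. $\widetilde H\supseteq H$ means that $\widetilde H$ is a Hilbert space containing $H$ as a closed subspace with the induced scalar product (up to isometric identification). A conjugation $J$ on $H$ is an antilinear operator on $H$ (defined on all of $H$) such that $J^2x=x$ for all $x\in H$ and $(Jx,Jy)_H=(y,x)_H$ for all $x,y\in H$. A linear operator $A$ in $H$ is called $J$-imaginary if $f\in D(A)$ implies $Jf\in D(A)$ and $AJf=-JAf$. The defect numbers of a closed symmetric operator $A$ are the (Hilbert space) dimensions of the defect subspaces $H\ominus (A-iE_H)D(A)$ and $H\ominus (A+iE_H)D(A)$, where $E_H$ is the identity operator on $H$. *)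

theory Defs
  imports "HOL-Analysis.Analysis" "HOL-Algebra.Module"
begin

text \<open>Complex Hilbert spaces as a type class; the scalar product is linear in its first argument.\<close>

class complex_hilbert_space = real_inner + complete_space +
  fixes scaleC :: "complex \<Rightarrow> 'a \<Rightarrow> 'a"
    and cinner :: "'a \<Rightarrow> 'a \<Rightarrow> complex"
  assumes scaleC_add_right: "scaleC a (x + y) = scaleC a x + scaleC a y"
    and scaleC_add_left: "scaleC (a + b) x = scaleC a x + scaleC b x"
    and scaleC_scaleC: "scaleC a (scaleC b x) = scaleC (a * b) x"
    and scaleC_of_real: "scaleC (of_real r) x = scaleR r x"
    and cinner_commute: "cinner y x = cnj (cinner x y)"
    and cinner_add_left: "cinner (x + y) z = cinner x z + cinner y z"
    and cinner_scaleC_left: "cinner (scaleC a x) y = a * cinner x y"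
    and inner_eq_Re_cinner: "inner x y = Re (cinner x y)"

text \<open>
  An existential statement cannot range over types, so a Hilbert space whose existence is asserted
  is a structure with an explicit carrier. All operator-theoretic notions are defined
  for such structures. The fields \<open>mult\<close> and \<open>one\<close>, inherited from the record of
  rings, are irrelevant.
\<close>

record 'v hspace = "(complex, 'v) module" +
  ip :: "'v \<Rightarrow> 'v \<Rightarrow> complex"

definition complex_ring :: "complex ring" where
  "complex_ring = \<lparr>carrier = UNIV, monoid.mult = (*), one = 1, zero = 0, add = (+)\<rparr>"

text \<open>The value \<open>0\<close> off the carrier only serves to meet the conventions of the locale
  \<open>Metric_space\<close>, which asks for symmetry and nonnegativity everywhere.\<close>

definition hdist :: "'v hspace \<Rightarrow> 'v \<Rightarrow> 'v \<Rightarrow> real" where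
  "hdist K x y =
     (if x \<in> carrier K \<and> y \<in> carrier K then sqrt (Re (ip K (x \<ominus>\<^bsub>K\<^esub> y) (x \<ominus>\<^bsub>K\<^esub> y))) else 0)"

definition htopology :: "'v hspace \<Rightarrow> 'v topology" where
  "htopology K = Metric_space.mtopology (carrier K) (hdist K)"

locale hilbert_space = Module.module complex_ring K for K :: "'v hspace" (structure) +
  assumes ip_add_left:
      "\<lbrakk>x \<in> carrier K; y \<in> carrier K; z \<in> carrier K\<rbrakk> \<Longrightarrow> ip K (x \<oplus> y) z = ip K x z + ip K y z"
    and ip_smult_left:
      "\<lbrakk>x \<in> carrier K; y \<in> carrier K\<rbrakk> \<Longrightarrow> ip K (a \<odot> x) y = a * ip K x y"
    and ip_commute:
      "\<lbrakk>x \<in> carrier K; y \<in> carrier K\<rbrakk> \<Longrightarrow> ip K y x = cnj (ip K x y)"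
    and ip_pos:
      "\<lbrakk>x \<in> carrier K; x \<noteq> \<zero>\<rbrakk> \<Longrightarrow> 0 < Re (ip K x x)"
    and complete:
      "Metric_space.mcomplete (carrier K) (hdist K)"

definition univ_space :: "'a::complex_hilbert_space hspace" where
  "univ_space = \<lparr>carrier = UNIV, monoid.mult = undefined, one = undefined,
     zero = 0, add = (+), smult = scaleC, ip = cinner\<rparr>"

definition isometric_embedding :: "'u hspace \<Rightarrow> 'v hspace \<Rightarrow> ('u \<Rightarrow> 'v) \<Rightarrow> bool" where
  "isometric_embedding H K V \<longleftrightarrow>
     V ` carrier H \<subseteq> carrier K \<and>
     (\<forall>x\<in>carrier H. \<forall>y\<in>carrier H. V (x \<oplus>\<^bsub>H\<^esub> y) = V x \<oplus>\<^bsub>K\<^esub> V y) \<and>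
     (\<forall>a. \<forall>x\<in>carrier H. V (a \<odot>\<^bsub>H\<^esub> x) = a \<odot>\<^bsub>K\<^esub> V x) \<and>
     (\<forall>x\<in>carrier H. \<forall>y\<in>carrier H. ip K (V x) (V y) = ip H x y) \<and>
     closedin (htopology K) (V ` carrier H)"

definition conjugation :: "'v hspace \<Rightarrow> ('v \<Rightarrow> 'v) \<Rightarrow> bool" where
  "conjugation K J \<longleftrightarrow>
     J ` carrier K \<subseteq> carrier K \<and>
     (\<forall>x\<in>carrier K. \<forall>y\<in>carrier K. J (x \<oplus>\<^bsub>K\<^esub> y) = J x \<oplus>\<^bsub>K\<^esub> J y) \<and>
     (\<forall>a. \<forall>x\<in>carrier K. J (a \<odot>\<^bsub>K\<^esub> x) = cnj a \<odot>\<^bsub>K\<^esub> J x) \<and>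
     (\<forall>x\<in>carrier K. J (J x) = x) \<and>
     (\<forall>x\<in>carrier K. \<forall>y\<in>carrier K. ip K (J x) (J y) = ip K y x)"

text \<open>Operators with a domain; the values of \<open>app\<close> outside the domain are irrelevant.\<close>

record 'v operator =
  Dom :: "'v set"
  app :: "'v \<Rightarrow> 'v"

definition linear_operator :: "'v hspace \<Rightarrow> 'v operator \<Rightarrow> bool" where
  "linear_operator K A \<longleftrightarrow>
     submodule (Dom A) complex_ring K \<and>
     app A ` Dom A \<subseteq> carrier K \<and>
     (\<forall>f\<in>Dom A. \<forall>g\<in>Dom A. app A (f \<oplus>\<^bsub>K\<^esub> g) = app A f \<oplus>\<^bsub>K\<^esub> app A g) \<and>
     (\<forall>a. \<forall>f\<in>Dom A. app A (a \<odot>\<^bsub>K\<^esub> f) = a \<odot>\<^bsub>K\<^esub> app A f)"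

definition extends_along :: "('u \<Rightarrow> 'v) \<Rightarrow> 'v operator \<Rightarrow> 'u operator \<Rightarrow> bool" where
  "extends_along V B A \<longleftrightarrow> V ` Dom A \<subseteq> Dom B \<and> (\<forall>f\<in>Dom A. app B (V f) = V (app A f))"

definition extends :: "'v operator \<Rightarrow> 'v operator \<Rightarrow> bool" where
  "extends B A \<longleftrightarrow> Dom A \<subseteq> Dom B \<and> (\<forall>f\<in>Dom A. app B f = app A f)"

definition densely_defined :: "'v hspace \<Rightarrow> 'v operator \<Rightarrow> bool" where
  "densely_defined K A \<longleftrightarrow> htopology K closure_of Dom A = carrier K"

definition closed_operator :: "'v hspace \<Rightarrow> 'v operator \<Rightarrow> bool" where
  "closed_operator K A \<longleftrightarrow>
     linear_operator K A \<and>
     closedin (prod_topology (htopology K) (htopology K)) ((\<lambda>f. (f, app A f)) ` Dom A)"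

definition symmetric_operator :: "'v hspace \<Rightarrow> 'v operator \<Rightarrow> bool" where
  "symmetric_operator K A \<longleftrightarrow>
     linear_operator K A \<and> (\<forall>f\<in>Dom A. \<forall>g\<in>Dom A. ip K (app A f) g = ip K f (app A g))"

definition adjoint_operator :: "'v hspace \<Rightarrow> 'v operator \<Rightarrow> 'v operator" where
  "adjoint_operator K A =
     \<lparr>Dom = {g \<in> carrier K. \<exists>h\<in>carrier K. \<forall>f\<in>Dom A. ip K (app A f) g = ip K f h},
      app = (\<lambda>g. THE h. h \<in> carrier K \<and> (\<forall>f\<in>Dom A. ip K (app A f) g = ip K f h))\<rparr>"

definition self_adjoint_operator :: "'v hspace \<Rightarrow> 'v operator \<Rightarrow> bool" where
  "self_adjoint_operator K A \<longleftrightarrow>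
     linear_operator K A \<and> densely_defined K A \<and>
     extends (adjoint_operator K A) A \<and> extends A (adjoint_operator K A)"

definition imaginary_operator :: "'v hspace \<Rightarrow> ('v \<Rightarrow> 'v) \<Rightarrow> 'v operator \<Rightarrow> bool" where
  "imaginary_operator K J A \<longleftrightarrow>
     linear_operator K A \<and>
     (\<forall>f\<in>Dom A. J f \<in> Dom A \<and> app A (J f) = \<ominus>\<^bsub>K\<^esub> J (app A f))"

definition closed_span :: "'v hspace \<Rightarrow> 'v set \<Rightarrow> 'v set" where
  "closed_span K B =
     \<Inter>{N. submodule N complex_ring K \<and> closedin (htopology K) N \<and> B \<subseteq> N}"

definition orthonormal_basis :: "'v hspace \<Rightarrow> 'v set \<Rightarrow> 'v set \<Rightarrow> bool" where
  "orthonormal_basis K M B \<longleftrightarrow>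
     B \<subseteq> M \<and> (\<forall>x\<in>B. \<forall>y\<in>B. ip K x y = (if x = y then 1 else 0)) \<and> closed_span K B = M"

text \<open>The Hilbert space dimension of a closed subspace, as a cardinal: cardinals are represented
  by relations and compared with \<open>ordIso\<close>. The choice of the basis is
  immaterial up to \<open>ordIso\<close>.\<close>

definition hilbert_dim :: "'v hspace \<Rightarrow> 'v set \<Rightarrow> 'v rel" where
  "hilbert_dim K M = card_of (SOME B. orthonormal_basis K M B)"

definition orth_complement :: "'v hspace \<Rightarrow> 'v set \<Rightarrow> 'v set" where
  "orth_complement K M = {x \<in> carrier K. \<forall>y\<in>M. ip K x y = 0}"

definition defect_subspace :: "'v hspace \<Rightarrow> 'v operator \<Rightarrow> complex \<Rightarrow> 'v set" where
  "defect_subspace K A z = orth_complement K ((\<lambda>f. app A f \<ominus>\<^bsub>K\<^esub> z \<odot>\<^bsub>K\<^esub> f) ` Dom A)"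

definition defect_number :: "'v hspace \<Rightarrow> 'v operator \<Rightarrow> complex \<Rightarrow> 'v rel" where
  "defect_number K A z = hilbert_dim K (defect_subspace K A z)"

definition equal_defect_numbers :: "'v hspace \<Rightarrow> 'v operator \<Rightarrow> bool" where
  "equal_defect_numbers K A \<longleftrightarrow>
     (defect_number K A \<i>, defect_number K A (- \<i>)) \<in> ordIso"

lemma univ_space_simps [simp]:
  "carrier univ_space = UNIV" "add univ_space = (+)" "zero univ_space = 0"
  "smult univ_space = scaleC" "ip univ_space = cinner"
  by (simp_all add: univ_space_def)

lemma scaleC_one: "scaleC 1 x = x" for x :: "'a::complex_hilbert_space"
  using scaleC_of_real[of 1 x] by simp

lemma abelian_group_univ_space: "abelian_group (univ_space :: 'a::complex_hilbert_space hspace)"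
proof (rule abelian_groupI)
  fix x :: 'a
  show "\<exists>y\<in>carrier univ_space. y \<oplus>\<^bsub>univ_space\<^esub> x = \<zero>\<^bsub>univ_space\<^esub>"
    by (auto intro: exI[of _ "- x"])
qed (simp_all add: algebra_simps)

lemma a_inv_univ_space [simp]: "\<ominus>\<^bsub>univ_space\<^esub> x = - x" for x :: "'a::complex_hilbert_space"
proof -
  interpret abelian_group "univ_space :: 'a hspace" by (rule abelian_group_univ_space)
  show ?thesis using minus_equality[of "- x" x] by simp
qed

lemma a_minus_univ_space [simp]: "x \<ominus>\<^bsub>univ_space\<^esub> y = x - y" for x :: "'a::complex_hilbert_space"
  by (simp add: a_minus_def)

lemma hdist_univ_space [simp]: "hdist univ_space = dist"
  by (intro ext) (simp add: hdist_def dist_norm norm_eq_sqrt_inner inner_eq_Re_cinner)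

lemma htopology_univ_space [simp]: "htopology univ_space = euclidean"
  by (simp add: htopology_def)

lemma cring_complex_ring: "cring complex_ring"
proof (rule cringI)
  show "abelian_group complex_ring"
    by (rule abelian_groupI)
       (auto simp: complex_ring_def algebra_simps intro: exI[of _ "- x" for x])
  show "Group.comm_monoid complex_ring"
    by (rule comm_monoidI) (auto simp: complex_ring_def)
qed (auto simp: complex_ring_def algebra_simps)

lemma hilbert_space_univ_space: "hilbert_space (univ_space :: 'a::complex_hilbert_space hspace)"
proof (intro hilbert_space.intro hilbert_space_axioms.intro)
  show "Module.module complex_ring (univ_space :: 'a hspace)"
    by (rule moduleI)
       (auto simp: cring_complex_ring abelian_group_univ_space, 
        auto simp: complex_ring_def scaleC_add_left scaleC_add_right scaleC_scaleC scaleC_one)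
  show "Metric_space.mcomplete (carrier (univ_space :: 'a hspace)) (hdist univ_space)"
    by (simp add: complete_UNIV)
  fix x :: 'a
  assume "x \<noteq> \<zero>\<^bsub>univ_space\<^esub>"
  then show "0 < Re (ip univ_space x x)"
    by (simp flip: inner_eq_Re_cinner)
qed (auto simp: cinner_add_left cinner_scaleC_left intro: cinner_commute)

end

theory Submission
  imports Defs
begin

text \<open>
  Since \<open>A J = - J A\<close>, the conjugation \<open>J\<close> maps each of the two defect subspaces into itself. By von
  Neumann, a unitary operator \<open>U\<close> from one defect subspace onto the other yields the self-adjoint
  extension \<open>f + n - U n \<mapsto> A f - \<i> n - \<i> U n\<close>, which is \<open>J\<close>-imaginary as soon as \<open>U\<close> commutes
  with \<open>J\<close>. If the defect numbers are equal, such a \<open>U\<close> maps a \<open>J\<close>-real orthonormal basis onto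
  another one. In general, pass to \<open>A \<oplus> (-A)\<close> in \<open>H \<oplus> H\<close>, whose defect subspaces are exchanged
  by the swap of the two summands.

  Operators are handled through their graphs: the domain of a symmetric linear relation being
  dense makes the relation single-valued, so that no well-definedness has to be checked.
\<close>

section \<open>The scalar product\<close>

lemma scaleC_minus1: "scaleC (-1) x = - x" for x :: "'a::complex_hilbert_space"
  using scaleC_of_real[of "-1" x] by simp

lemma scaleC_zero_right [simp]: "scaleC a 0 = (0::'a::complex_hilbert_space)"
  using scaleC_add_right[of a 0 0] by simp

lemma scaleC_zero_left [simp]: "scaleC 0 x = (0::'a::complex_hilbert_space)"
  using scaleC_of_real[of 0 x] by simp

lemma scaleC_minus_right: "scaleC a (- x) = - scaleC a x" for x :: "'a::complex_hilbert_space"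
  using scaleC_add_right[of a x "- x"] by (simp add: eq_neg_iff_add_eq_0 add.commute)

lemma scaleC_minus_left: "scaleC (- a) x = - scaleC a x" for x :: "'a::complex_hilbert_space"
  using scaleC_add_left[of a "- a" x] by (simp add: eq_neg_iff_add_eq_0 add.commute)

lemma scaleC_diff_right: "scaleC a (x - y) = scaleC a x - scaleC a y"
  for x :: "'a::complex_hilbert_space"
  using scaleC_add_right[of a x "- y"] by (simp add: scaleC_minus_right)

text \<open>Reduces a varying complex scalar to real operations and the fixed map
  \<open>scaleC \<i>\<close>, so that continuity in the scalar follows from the real rules.\<close>

lemma scaleC_eq: "scaleC a x = Re a *\<^sub>R x + Im a *\<^sub>R scaleC \<i> x"
  for x :: "'a::complex_hilbert_space"
proof -
  have "scaleC a x = scaleC (of_real (Re a) + of_real (Im a) * \<i>) x"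
    by (metis complex_eq mult.commute)
  then show ?thesis
    by (simp add: scaleC_add_left scaleC_of_real flip: scaleC_scaleC)
qed

lemma cinner_add_right: "cinner x (y + z) = cinner x y + cinner x z"
  for x :: "'a::complex_hilbert_space"
  by (metis cinner_add_left cinner_commute complex_cnj_add)

lemma cinner_scaleC_right: "cinner x (scaleC a y) = cnj a * cinner x y"
  for x :: "'a::complex_hilbert_space"
  by (metis cinner_commute cinner_scaleC_left complex_cnj_mult)

lemma cinner_zero_left [simp]: "cinner 0 x = 0" for x :: "'a::complex_hilbert_space"
  using cinner_add_left[of 0 0 x] by simp

lemma cinner_zero_right [simp]: "cinner x 0 = 0" for x :: "'a::complex_hilbert_space"
  using cinner_add_right[of x 0 0] by simp

lemma cinner_minus_left: "cinner (- x) y = - cinner x y" for x :: "'a::complex_hilbert_space"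
  using cinner_add_left[of x "- x" y] by (simp add: eq_neg_iff_add_eq_0 add.commute)

lemma cinner_minus_right: "cinner x (- y) = - cinner x y" for x :: "'a::complex_hilbert_space"
  using cinner_add_right[of x y "- y"] by (simp add: eq_neg_iff_add_eq_0 add.commute)

lemma cinner_diff_left: "cinner (x - y) z = cinner x z - cinner y z"
  for x :: "'a::complex_hilbert_space"
  using cinner_add_left[of x "- y" z] by (simp add: cinner_minus_left)

lemma cinner_diff_right: "cinner x (y - z) = cinner x y - cinner x z"
  for x :: "'a::complex_hilbert_space"
  using cinner_add_right[of x y "- z"] by (simp add: cinner_minus_right)

lemma cinner_sum_left: "cinner (\<Sum>i\<in>I. f i) y = (\<Sum>i\<in>I. cinner (f i) y)"
  for y :: "'a::complex_hilbert_space"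
  by (induction I rule: infinite_finite_induct) (auto simp: cinner_add_left)

lemma cinner_sum_right: "cinner y (\<Sum>i\<in>I. f i) = (\<Sum>i\<in>I. cinner y (f i))"
  for y :: "'a::complex_hilbert_space"
  by (induction I rule: infinite_finite_induct) (auto simp: cinner_add_right)

lemmas cinner_simps = cinner_add_left cinner_add_right cinner_diff_left cinner_diff_right
  cinner_minus_left cinner_minus_right cinner_scaleC_left cinner_scaleC_right

text \<open>The imaginary part of a scalar product is a real inner product against
  \<open>scaleC \<i> y\<close>. Continuity and orthogonality thus pass from the real to the complex
  structure.\<close>

lemma cinner_eq: "cinner x y = Complex (inner x y) (inner x (scaleC \<i> y))"
  for x :: "'a::complex_hilbert_space"
  by (simp add: complex_eq_iff inner_eq_Re_cinner cinner_scaleC_right)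

lemma cinner_self: "cinner x x = of_real ((norm x)\<^sup>2)" for x :: "'a::complex_hilbert_space"
proof -
  have "Im (cinner x x) = 0"
    using cinner_commute[of x x] by (simp add: complex_eq_iff)
  then show ?thesis
    by (simp add: complex_eq_iff power2_norm_eq_inner inner_eq_Re_cinner)
qed

lemma cinner_self_eq_0 [simp]: "cinner x x = 0 \<longleftrightarrow> x = 0" for x :: "'a::complex_hilbert_space"
  by (simp add: cinner_self)

lemma cinner_eq_0_commute: "cinner x y = 0 \<longleftrightarrow> cinner y x = 0" for x :: "'a::complex_hilbert_space"
  by (metis cinner_commute complex_cnj_zero_iff)

lemma norm_scaleC: "norm (scaleC a x) = cmod a * norm x" for x :: "'a::complex_hilbert_space"
proof -
  have "complex_of_real ((norm (scaleC a x))\<^sup>2) = a * cnj a * cinner x x"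
    by (metis cinner_scaleC_left cinner_scaleC_right cinner_self mult.assoc)
  also have "\<dots> = of_real ((cmod a * norm x)\<^sup>2)"
    unfolding cinner_self by (simp add: power_mult_distrib flip: complex_norm_square)
  finally show ?thesis
    by (metis norm_ge_zero of_real_eq_iff power2_eq_imp_eq mult_nonneg_nonneg)
qed

lemma bounded_linear_scaleC: "bounded_linear (scaleC a :: 'a::complex_hilbert_space \<Rightarrow> 'a)"
proof (rule bounded_linear_intro[where K = "cmod a"])
  show "scaleC a (r *\<^sub>R x) = r *\<^sub>R scaleC a x" for r and x :: 'a
    by (simp add: scaleC_scaleC mult.commute flip: scaleC_of_real)
qed (simp_all add: scaleC_add_right norm_scaleC)

lemma continuous_on_scaleC [continuous_intros]:
  fixes f :: "'b::topological_space \<Rightarrow> 'a::complex_hilbert_space"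
  shows "continuous_on S f \<Longrightarrow> continuous_on S (\<lambda>x. scaleC a (f x))"
  by (rule bounded_linear.continuous_on[OF bounded_linear_scaleC])

lemma continuous_on_cinner [continuous_intros]:
  fixes f :: "'b::topological_space \<Rightarrow> 'a::complex_hilbert_space"
  assumes "continuous_on S f" "continuous_on S g"
  shows "continuous_on S (\<lambda>x. cinner (f x) (g x))"
  unfolding cinner_eq Complex_eq by (intro continuous_intros assms)

section \<open>The direct sum of two Hilbert spaces\<close>

instantiation prod :: (complex_hilbert_space, complex_hilbert_space) complex_hilbert_space
begin

definition "scaleC a x = (scaleC a (fst x), scaleC a (snd x))"
definition "cinner x y = cinner (fst x) (fst y) + cinner (snd x) (snd y)"

instance
proof
  fix x y :: "'a \<times> 'b"
  show "cinner y x = cnj (cinner x y)"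
    unfolding cinner_prod_def by (metis cinner_commute complex_cnj_add)
qed (auto simp: scaleC_prod_def cinner_prod_def scaleC_add_left scaleC_add_right scaleC_scaleC
  scaleC_of_real cinner_add_left cinner_scaleC_left inner_prod_def inner_eq_Re_cinner
  scaleR_prod_def algebra_simps)

end

lemma scaleC_Pair [simp]: "scaleC a (x, y) = (scaleC a x, scaleC a y)"
  by (simp add: scaleC_prod_def)

lemma cinner_Pair [simp]: "cinner (x, y) (x', y') = cinner x x' + cinner y y'"
  by (simp add: cinner_prod_def)

section \<open>Complex subspaces and orthogonal projection\<close>

text \<open>Built on the real \<open>subspace\<close>, so that results on real normed spaces apply;
  \<open>submodule_univ_space_iff\<close> ties it to the submodules of the operator-theoretic
  definitions.\<close>

definition csubspace :: "'a::complex_hilbert_space set \<Rightarrow> bool" where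
  "csubspace S \<longleftrightarrow> subspace S \<and> (\<forall>a. \<forall>x\<in>S. scaleC a x \<in> S)"

lemma csubspaceI:
  assumes "0 \<in> S" "\<And>x y. x \<in> S \<Longrightarrow> y \<in> S \<Longrightarrow> x + y \<in> S" "\<And>a x. x \<in> S \<Longrightarrow> scaleC a x \<in> S"
  shows "csubspace S"
  unfolding csubspace_def subspace_def using assms by (metis scaleC_of_real)

lemma csubspaceD:
  assumes "csubspace S"
  shows "0 \<in> S" "\<And>x y. x \<in> S \<Longrightarrow> y \<in> S \<Longrightarrow> x + y \<in> S" "\<And>x y. x \<in> S \<Longrightarrow> y \<in> S \<Longrightarrow> x - y \<in> S"
    "\<And>x. x \<in> S \<Longrightarrow> - x \<in> S" "\<And>a x. x \<in> S \<Longrightarrow> scaleC a x \<in> S"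
  using assms by (auto simp: csubspace_def subspace_0 subspace_add subspace_diff subspace_neg)

lemma submodule_univ_space_iff: "submodule S complex_ring univ_space \<longleftrightarrow> csubspace S"
proof
  assume S: "submodule S complex_ring univ_space"
  interpret submodule S complex_ring univ_space by (rule S)
  show "csubspace S"
    using one_closed m_closed smult_closed by (intro csubspaceI) (auto simp: complex_ring_def)
next
  assume "csubspace S"
  then show "submodule S complex_ring univ_space"
    using hilbert_space_univ_space csubspaceD[of S]
    by (intro Module.module.submoduleI) (auto simp: hilbert_space_def)
qed

section \<open>Closed spans and closed images\<close>

lemma closed_span_univ_space:
  "closed_span univ_space B = \<Inter>{S. csubspace S \<and> closed S \<and> B \<subseteq> S}"
  by (simp add: closed_span_def submodule_univ_space_iff)

lemma csubspace_closed_span: "csubspace (closed_span univ_space B)"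
  unfolding closed_span_univ_space by (rule csubspaceI) (auto dest: csubspaceD)

lemma closed_closed_span: "closed (closed_span univ_space B)"
  unfolding closed_span_univ_space by auto

lemma closed_span_superset: "B \<subseteq> closed_span univ_space B"
  unfolding closed_span_univ_space by auto

lemma closed_span_minimal:
  "csubspace S \<Longrightarrow> closed S \<Longrightarrow> B \<subseteq> S \<Longrightarrow> closed_span univ_space B \<subseteq> S"
  unfolding closed_span_univ_space by auto

lemma csubspace_linear_image:
  assumes "csubspace S" "bounded_linear f" "\<And>a x. f (scaleC a x) = scaleC a (f x)"
  shows "csubspace (f ` S)"
proof (rule csubspaceI)
  interpret bounded_linear f by (rule assms)
  show "0 \<in> f ` S"
    using csubspaceD(1)[OF assms(1)] by (metis image_eqI zero)
  show "x + y \<in> f ` S" if "x \<in> f ` S" "y \<in> f ` S" for x y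
    using that csubspaceD(2)[OF assms(1)] by (auto simp flip: add)
  show "scaleC a x \<in> f ` S" if "x \<in> f ` S" for a x
    using that csubspaceD(5)[OF assms(1)] by (auto simp flip: assms(3))
qed

text \<open>A linear map bounded below reflects Cauchy sequences, so the image of a complete
  subspace is complete.\<close>

lemma closed_bounded_below_image:
  fixes f :: "'a::complex_hilbert_space \<Rightarrow> 'b::complex_hilbert_space"
  assumes "csubspace S" "closed S" "bounded_linear f" "0 < e"
    and "\<And>x. x \<in> S \<Longrightarrow> e * norm x \<le> norm (f x)"
  shows "closed (f ` S)"
  using assms complete_isometric_image[of e S f]
  by (auto simp: csubspace_def complete_eq_closed)

section \<open>Orthogonal complements and closest points\<close>

lemma csubspace_orth: "csubspace {x. \<forall>y\<in>S. cinner x y = 0}"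
  by (rule csubspaceI) (auto simp: cinner_simps)

lemma closed_orth: "closed {x::'a::complex_hilbert_space. \<forall>y\<in>S. cinner x y = 0}"
proof -
  have "{x. \<forall>y\<in>S. cinner x y = 0} = (\<Inter>y\<in>S. {x. cinner x y = 0})"
    by auto
  then show ?thesis
    by (auto intro!: closed_INT closed_Collect_eq continuous_intros)
qed

text \<open>The sets \<open>C n\<close> of almost closest points are closed, nonempty and
  decreasing. The parallelogram law makes their diameters tend to 0, so by completeness they have a
  common point, and it attains the infimum \<open>d\<close>.\<close>

lemma closest_point_exists:
  fixes S :: "'a::complex_hilbert_space set"
  assumes "subspace S" "closed S"
  shows "\<exists>m\<in>S. \<forall>y\<in>S. norm (x - m) \<le> norm (x - y)"
proof -
  define d where "d = (INF y\<in>S. (norm (x - y))\<^sup>2)"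
  define C where "C n = S \<inter> {y. (norm (x - y))\<^sup>2 \<le> d + 1 / Suc n}" for n
  have ne: "S \<noteq> {}"
    using assms(1) subspace_0 by blast
  have bdd: "bdd_below ((\<lambda>y. (norm (x - y))\<^sup>2) ` S)"
    by (rule bdd_belowI[of _ 0]) auto
  have d_le: "d \<le> (norm (x - y))\<^sup>2" if "y \<in> S" for y
    unfolding d_def using that bdd by (rule cINF_lower[rotated])
  obtain m where m: "\<And>n. m \<in> C n"
  proof (rule decreasing_closed_nest[of C])
    show "closed (C n)" for n
      unfolding C_def by (intro closed_Int assms closed_Collect_le continuous_intros)
    show "C n \<noteq> {}" for n
    proof -
      have "\<exists>y\<in>S. (norm (x - y))\<^sup>2 < d + 1 / Suc n"
        using cINF_less_iff[OF ne bdd, of "d + 1 / Suc n"] by (simp flip: d_def)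
      then show ?thesis
        by (force simp: C_def)
    qed
    show "C n \<subseteq> C m" if "m \<le> n" for m n
    proof -
      have "1 / real (Suc n) \<le> 1 / real (Suc m)"
        using that by (intro divide_left_mono) auto
      then show ?thesis
        by (auto simp: C_def)
    qed
    show "\<exists>n. \<forall>y\<in>C n. \<forall>z\<in>C n. dist y z < e" if "0 < e" for e
    proof -
      \<comment> \<open>Two points of \<open>C n\<close> have squared distance at most
        \<open>4 / Suc n\<close>, hence the bound \<open>e\<^sup>2 / 4\<close>.\<close>
      obtain n where n: "inverse (real (Suc n)) < e\<^sup>2 / 4"
        using reals_Archimedean[of "e\<^sup>2 / 4"] \<open>0 < e\<close> by (auto simp del: of_nat_Suc)
      have "dist y z < e" if "y \<in> C n" "z \<in> C n" for y z
      proof -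
        have "(1/2) *\<^sub>R (y + z) \<in> S"
          using that assms(1) by (auto simp: C_def subspace_add subspace_scale)
        then have "d \<le> (norm (x - (1/2) *\<^sub>R (y + z)))\<^sup>2"
          by (rule d_le)
        \<comment> \<open>The parallelogram law for \<open>x - y\<close> and \<open>x - z\<close>;
          the midpoint lies in \<open>S\<close>, so its squared distance from \<open>x\<close> is at
          least \<open>d\<close>.\<close>
        moreover have "(norm (y - z))\<^sup>2 + 4 * (norm (x - (1/2) *\<^sub>R (y + z)))\<^sup>2
            = 2 * (norm (x - y))\<^sup>2 + 2 * (norm (x - z))\<^sup>2"
          by (simp add: power2_norm_eq_inner inner_simps inner_commute field_simps)
        moreover have "(norm (x - y))\<^sup>2 \<le> d + inverse (Suc n)" "(norm (x - z))\<^sup>2 \<le> d + inverse (Suc n)"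
          using that by (auto simp: C_def divide_inverse)
        ultimately have "(norm (y - z))\<^sup>2 < e\<^sup>2"
          using n by argo
        then show ?thesis
          using \<open>0 < e\<close> by (simp add: dist_norm power_less_imp_less_base)
      qed
      then show ?thesis
        by blast
    qed
  qed blast
  have "(norm (x - m))\<^sup>2 \<le> d"
  proof (rule field_le_epsilon)
    fix e :: real
    assume "0 < e"
    then obtain n where "inverse (real (Suc n)) < e"
      using reals_Archimedean by blast
    moreover have "(norm (x - m))\<^sup>2 \<le> d + inverse (Suc n)"
      using m[of n] by (simp add: C_def divide_inverse)
    ultimately show "(norm (x - m))\<^sup>2 \<le> d + e"
      by linarith
  qed
  then have "\<forall>y\<in>S. norm (x - m) \<le> norm (x - y)"
    using d_le by (meson norm_ge_zero order_trans power2_le_imp_le)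
  then show ?thesis
    using m by (auto simp: C_def)
qed

lemma orthogonal_decomposition:
  fixes S :: "'a::complex_hilbert_space set"
  assumes "csubspace S" "closed S"
  obtains m where "m \<in> S" "\<And>y. y \<in> S \<Longrightarrow> cinner (x - m) y = 0"
proof -
  have S: "subspace S"
    using assms by (simp add: csubspace_def)
  obtain m where m: "m \<in> S" "\<And>y. y \<in> S \<Longrightarrow> norm (x - m) \<le> norm (x - y)"
    using closest_point_exists[OF S assms(2)] by blast
  have *: "inner (x - m) y = 0" if "y \<in> S" for y
  proof (cases "y = 0")
    case False
    \<comment> \<open>The value minimizing \<open>norm (x - m - t *\<^sub>R y)\<close>: unless the
      inner product vanishes, \<open>m + t *\<^sub>R y\<close> would be closer to \<open>x\<close>
      than \<open>m\<close>.\<close>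
    define t where "t = inner (x - m) y / (norm y)\<^sup>2"
    have "m + t *\<^sub>R y \<in> S"
      using m(1) that S by (simp add: subspace_add subspace_scale)
    then have "(norm (x - m))\<^sup>2 \<le> (norm (x - m - t *\<^sub>R y))\<^sup>2"
      using m(2) by (simp add: diff_diff_eq)
    also have "\<dots> = (norm (x - m))\<^sup>2 - 2 * t * inner (x - m) y + t\<^sup>2 * (norm y)\<^sup>2"
      unfolding power2_norm_eq_inner
      by (simp add: inner_simps inner_commute power2_eq_square algebra_simps)
    also have "\<dots> = (norm (x - m))\<^sup>2 - (inner (x - m) y)\<^sup>2 / (norm y)\<^sup>2"
      using False by (simp add: t_def field_simps power2_eq_square)
    finally show ?thesis
      using False by (simp add: divide_le_0_iff)
  qed simp
  \<comment> \<open>Real orthogonality to both \<open>y\<close> and \<open>scaleC \<i> y\<close> is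
    complex orthogonality to \<open>y\<close>.\<close>
  have "cinner (x - m) y = 0" if "y \<in> S" for y
    using that *[of y] *[of "scaleC \<i> y"] csubspaceD(5)[OF assms(1)]
    by (simp add: cinner_eq complex_eq_iff)
  then show ?thesis
    using m(1) that by blast
qed

section \<open>Symmetric linear relations\<close>

definition symmetric_relation :: "('a::complex_hilbert_space \<times> 'a) set \<Rightarrow> bool" where
  "symmetric_relation G \<longleftrightarrow>
     (\<forall>x y x' y'. (x, y) \<in> G \<longrightarrow> (x', y') \<in> G \<longrightarrow> cinner y x' = cinner x y')"

text \<open>The orthogonal complement of the range of \<open>G - z\<close>. For the graph of a
  densely defined operator this is the eigenspace of the adjoint at \<open>cnj z\<close>.\<close>

definition relation_defect ::
  "('a::complex_hilbert_space \<times> 'a) set \<Rightarrow> complex \<Rightarrow> 'a set" where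
  "relation_defect G z = {w. \<forall>x y. (x, y) \<in> G \<longrightarrow> cinner w (y - scaleC z x) = 0}"

lemma relation_defect_eq_orth:
  "relation_defect G z = {w. \<forall>v\<in>(\<lambda>(x, y). y - scaleC z x) ` G. cinner w v = 0}"
  by (force simp: relation_defect_def)

lemma csubspace_relation_defect: "csubspace (relation_defect G z)"
  unfolding relation_defect_eq_orth by (rule csubspace_orth)

lemma closed_relation_defect: "closed (relation_defect G z)"
  unfolding relation_defect_eq_orth by (rule closed_orth)

lemma dense_orth_0:
  assumes "closure S = UNIV" "\<And>x. x \<in> S \<Longrightarrow> cinner x h = 0"
  shows "h = (0::'a::complex_hilbert_space)"
proof -
  have "closure S \<subseteq> {x. cinner x h = 0}"
    using assms(2) by (intro closure_minimal closed_Collect_eq continuous_intros) auto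
  then have "h \<in> {x. cinner x h = 0}"
    using assms(1) by blast
  then show ?thesis
    by simp
qed

section \<open>Conjugations\<close>

lemma conjugation_univ_spaceD:
  assumes "conjugation univ_space J"
  shows "J (x + y) = J x + J y" "J (scaleC a x) = scaleC (cnj a) (J x)" "J (J x) = x"
    "cinner (J x) (J y) = cinner y x" "J (x - y) = J x - J y" "J (- x) = - J x" "J 0 = 0"
proof -
  show add: "J (x + y) = J x + J y" and sc: "J (scaleC a x) = scaleC (cnj a) (J x)"
    and "J (J x) = x" "cinner (J x) (J y) = cinner y x" for x y a
    using assms by (auto simp: conjugation_def)
  show minus: "J (- x) = - J x" for x
    using sc[of "-1" x] by (simp add: scaleC_minus1)
  show "J (x - y) = J x - J y"
    using add[of x "- y"] by (simp add: minus)
  show "J 0 = 0"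
    using sc[of 0 0] by simp
qed

lemma conjugation_norm:
  assumes "conjugation univ_space J"
  shows "norm (J x) = norm x"
proof -
  have "complex_of_real ((norm (J x))\<^sup>2) = of_real ((norm x)\<^sup>2)"
    unfolding cinner_self[symmetric] by (rule conjugation_univ_spaceD[OF assms])
  then show ?thesis
    by (metis norm_ge_zero of_real_eq_iff power2_eq_imp_eq)
qed

lemma bounded_linear_conjugation:
  assumes "conjugation univ_space J"
  shows "bounded_linear J"
  using conjugation_univ_spaceD[OF assms] conjugation_norm[OF assms]
  by (intro bounded_linear_intro[where K = 1]) (auto simp flip: scaleC_of_real)

section \<open>Self-adjointness and von Neumann's extension\<close>

text \<open>If \<open>(g, h)\<close> belongs to the adjoint of \<open>R\<close>, surjectivity of
  \<open>R - \<i>\<close> gives \<open>(x, y)\<close> in \<open>R\<close> with the same value as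
  \<open>(g, h)\<close> under \<open>R - \<i>\<close>. Then \<open>g - x\<close> is orthogonal to
  the range of \<open>R + \<i>\<close>, which is the whole space, so \<open>(g, h) = (x, y)\<close>
  lies in \<open>R\<close>.\<close>

lemma self_adjoint_operator_of_relation:
  fixes R :: "('a::complex_hilbert_space \<times> 'a) set"
  assumes R: "csubspace R" and sym: "symmetric_relation R" and dense: "closure (fst ` R) = UNIV"
    and onto1: "\<And>h. \<exists>x y. (x, y) \<in> R \<and> y - scaleC \<i> x = h"
    and onto2: "\<And>h. \<exists>x y. (x, y) \<in> R \<and> y + scaleC \<i> x = h"
  obtains B where "self_adjoint_operator univ_space B" "Dom B = fst ` R"
    "\<And>x y. (x, y) \<in> R \<Longrightarrow> app B x = y"
proof -
  have symD: "cinner y x' = cinner x y'" if "(x, y) \<in> R" "(x', y') \<in> R" for x y x' y'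
    using sym that unfolding symmetric_relation_def by blast
  \<comment> \<open>By symmetry, \<open>(0, v)\<close> in \<open>R\<close> forces \<open>v\<close>
    to be orthogonal to the dense domain.\<close>
  have unique: "y = y'" if "(x, y) \<in> R" "(x, y') \<in> R" for x y y'
  proof -
    have "(0, y - y') \<in> R"
      using csubspaceD(3)[OF R that] by simp
    then have "cinner k (y - y') = 0" if "k \<in> fst ` R" for k
      using symD that by fastforce
    then show ?thesis
      using dense_orth_0[OF dense, of "y - y'"] by simp
  qed
  define B where "B = \<lparr>Dom = fst ` R, app = (\<lambda>x. THE y. (x, y) \<in> R)\<rparr>"
  have Dom: "Dom B = fst ` R"
    by (simp add: B_def)
  have app: "app B x = y" if "(x, y) \<in> R" for x y
    using that unique by (auto simp: B_def)
  have app_in: "(x, app B x) \<in> R" if "x \<in> Dom B" for x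
    using that app by (force simp: Dom)
  have lin: "linear_operator univ_space B"
    unfolding linear_operator_def submodule_univ_space_iff
  proof (intro conjI ballI allI)
    show "csubspace (Dom B)"
      unfolding Dom using R
      by (rule csubspace_linear_image) (auto simp: bounded_linear_fst scaleC_prod_def)
    show "app B (f \<oplus>\<^bsub>univ_space\<^esub> g) = app B f \<oplus>\<^bsub>univ_space\<^esub> app B g"
      if "f \<in> Dom B" "g \<in> Dom B" for f g
      using csubspaceD(2)[OF R app_in[OF that(1)] app_in[OF that(2)]] by (simp add: app)
    show "app B (a \<odot>\<^bsub>univ_space\<^esub> f) = a \<odot>\<^bsub>univ_space\<^esub> app B f" if "f \<in> Dom B" for a f
      using csubspaceD(5)[OF R app_in[OF that], of a] by (simp add: app)
  qed auto
  have adj: "(g, h) \<in> R" if gh: "\<And>f. f \<in> Dom B \<Longrightarrow> cinner (app B f) g = cinner f h" for g h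
  proof -
    obtain x y where xy: "(x, y) \<in> R" "y - scaleC \<i> x = h - scaleC \<i> g"
      using onto1 by blast
    have "cinner w (g - x) = 0" for w
    proof -
      obtain k l where kl: "(k, l) \<in> R" "l + scaleC \<i> k = w"
        using onto2 by blast
      have "cinner w g = cinner k (h - scaleC \<i> g)"
        using gh[of k] kl app[OF kl(1)] by (force simp: Dom cinner_simps)
      also have "\<dots> = cinner w x"
        using symD[OF kl(1) xy(1)] by (auto simp flip: xy(2) kl(2) simp: cinner_simps)
      finally show ?thesis
        by (simp add: cinner_simps)
    qed
    then have "g = x"
      by (metis cinner_self_eq_0 right_minus_eq)
    with xy show ?thesis
      by simp
  qed
  have adj_app: "app (adjoint_operator univ_space B) g = h" if "(g, h) \<in> R" for g h
    unfolding adjoint_operator_def operator.simps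
  proof (rule the_equality)
    show "h \<in> carrier univ_space
      \<and> (\<forall>f\<in>Dom B. ip univ_space (app B f) g = ip univ_space f h)"
      using symD[OF app_in that] by simp
    show "k = h" if "k \<in> carrier univ_space
      \<and> (\<forall>f\<in>Dom B. ip univ_space (app B f) g = ip univ_space f k)" for k
      using that adj[of g k] unique \<open>(g, h) \<in> R\<close> by auto
  qed
  have adj_Dom: "Dom (adjoint_operator univ_space B) = Dom B"
  proof (intro subset_antisym subsetI)
    fix g
    assume "g \<in> Dom (adjoint_operator univ_space B)"
    then obtain h where "\<And>f. f \<in> Dom B \<Longrightarrow> cinner (app B f) g = cinner f h"
      by (auto simp: adjoint_operator_def)
    then have "(g, h) \<in> R"
      by (rule adj)
    then show "g \<in> Dom B"
      unfolding Dom by force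
  next
    fix g
    assume "g \<in> Dom B"
    then show "g \<in> Dom (adjoint_operator univ_space B)"
      using symD[OF app_in app_in] by (auto simp: adjoint_operator_def)
  qed
  have "self_adjoint_operator univ_space B"
    unfolding self_adjoint_operator_def extends_def adj_Dom
    using lin dense adj_app app by (auto simp: densely_defined_def Dom)
  then show ?thesis
    using that Dom app by blast
qed

text \<open>The cross terms cancel by symmetry. Thus \<open>G - z\<close> is isometric for the graph
  norm, which is what makes its range closed.\<close>

lemma norm_symmetric_pair:
  assumes "cinner y x = cinner x y" "z = \<i> \<or> z = - \<i>"
  shows "norm (y - scaleC z x) = norm (x, y :: 'a::complex_hilbert_space)"
proof -
  have "cinner (y - scaleC z x) (y - scaleC z x) = cinner (x, y) (x, y)"
    using assms by (auto simp: cinner_simps algebra_simps)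
  then have "complex_of_real ((norm (y - scaleC z x))\<^sup>2) = of_real ((norm (x, y))\<^sup>2)"
    unfolding cinner_self .
  then show ?thesis
    by (metis norm_ge_zero of_real_eq_iff power2_eq_imp_eq)
qed

text \<open>The range of \<open>G - z\<close> is the isometric image of the closed subspace
  \<open>G\<close>, hence closed; projecting \<open>h\<close> onto it leaves a remainder in the
  defect subspace.\<close>

lemma relation_defect_decomposition:
  fixes G :: "('a::complex_hilbert_space \<times> 'a) set"
  assumes G: "csubspace G" "closed G" and sym: "symmetric_relation G" and z: "z = \<i> \<or> z = - \<i>"
  shows "\<exists>x y n. (x, y) \<in> G \<and> n \<in> relation_defect G z \<and> h = y - scaleC z x + n"
proof -
  let ?T = "\<lambda>(x, y). y - scaleC z x"
  have T: "bounded_linear ?T"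
    unfolding case_prod_unfold
    by (intro bounded_linear_sub bounded_linear_snd bounded_linear_compose[OF bounded_linear_scaleC]
        bounded_linear_fst)
  have "csubspace (?T ` G)"
    using G(1) T by (rule csubspace_linear_image)
      (auto simp: scaleC_prod_def scaleC_diff_right scaleC_scaleC mult.commute)
  moreover have "closed (?T ` G)"
  proof (rule closed_bounded_below_image[OF G T])
    show "1 * norm p \<le> norm (?T p)" if "p \<in> G" for p
      using that sym z norm_symmetric_pair[of "snd p" "fst p" z]
      by (cases p) (auto simp: symmetric_relation_def)
  qed simp
  ultimately obtain m where m: "m \<in> ?T ` G" "\<And>v. v \<in> ?T ` G \<Longrightarrow> cinner (h - m) v = 0"
    using orthogonal_decomposition by blast
  then have "h - m \<in> relation_defect G z"
    by (auto simp: relation_defect_eq_orth)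
  moreover obtain x y where "(x, y) \<in> G" "m = y - scaleC z x"
    using m(1) by auto
  ultimately show ?thesis
    by (intro exI[of _ x] exI[of _ y] exI[of _ "h - m"]) simp
qed

text \<open>Von Neumann's extension along the graph \<open>P\<close> of a unitary operator from one defect subspace
  onto the other.\<close>

lemma von_neumann_extension:
  fixes G P :: "('a::complex_hilbert_space \<times> 'a) set"
  assumes G: "csubspace G" "closed G" and sym: "symmetric_relation G"
    and dense: "closure (fst ` G) = UNIV"
    and J: "conjugation univ_space J" and GJ: "\<And>x y. (x, y) \<in> G \<Longrightarrow> (J x, - J y) \<in> G"
    and P: "csubspace P" and P1: "fst ` P = relation_defect G \<i>"
    and P2: "snd ` P = relation_defect G (- \<i>)"
    and Piso: "\<And>n m n' m'. (n, m) \<in> P \<Longrightarrow> (n', m') \<in> P \<Longrightarrow> cinner n n' = cinner m m'"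
    and PJ: "\<And>n m. (n, m) \<in> P \<Longrightarrow> (J n, J m) \<in> P"
  obtains B where "self_adjoint_operator univ_space B" "imaginary_operator univ_space J B"
    "\<And>x y. (x, y) \<in> G \<Longrightarrow> x \<in> Dom B \<and> app B x = y"
proof -
  \<comment> \<open>The adjoint of \<open>G\<close> sends \<open>n\<close> to
    \<open>- scaleC \<i> n\<close> and \<open>m\<close> to \<open>scaleC \<i> m\<close>. The second
    component is therefore the value of the adjoint at \<open>f + n - m\<close>.\<close>
  define R where "R = {(f + n - m, g - scaleC \<i> n - scaleC \<i> m) | f g n m. (f, g) \<in> G \<and> (n, m) \<in> P}"
  have RI: "(f + n - m, g - scaleC \<i> n - scaleC \<i> m) \<in> R" if "(f, g) \<in> G" "(n, m) \<in> P" for f g n m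
    using that unfolding R_def by blast
  have RE: "\<exists>f g n m. p = (f + n - m, g - scaleC \<i> n - scaleC \<i> m) \<and> (f, g) \<in> G \<and> (n, m) \<in> P"
    if "p \<in> R" for p
    using that unfolding R_def by blast
  have G0: "(0, 0) \<in> G" and P0: "(0, 0) \<in> P"
    using csubspaceD(1)[OF G(1)] csubspaceD(1)[OF P] by (auto simp: zero_prod_def)
  have GR: "p \<in> R" if "p \<in> G" for p
    using RI[OF _ P0, of "fst p" "snd p"] that by simp
  have R: "csubspace R"
  proof (rule csubspaceI)
    show "0 \<in> R"
      using GR[OF G0] by (simp add: zero_prod_def)
    show "p + q \<in> R" if pq: "p \<in> R" "q \<in> R" for p q
    proof -
      obtain f g n m where 1: "p = (f + n - m, g - scaleC \<i> n - scaleC \<i> m)" "(f, g) \<in> G" "(n, m) \<in> P"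
        using RE[OF pq(1)] by blast
      obtain f' g' n' m' where 2: "q = (f' + n' - m', g' - scaleC \<i> n' - scaleC \<i> m')"
        "(f', g') \<in> G" "(n', m') \<in> P"
        using RE[OF pq(2)] by blast
      have "(f + f', g + g') \<in> G" "(n + n', m + m') \<in> P"
        using csubspaceD(2)[OF G(1) 1(2) 2(2)] csubspaceD(2)[OF P 1(3) 2(3)] by auto
      from RI[OF this] show ?thesis
        by (simp add: 1 2 scaleC_add_right algebra_simps)
    qed
    show "scaleC a p \<in> R" if p: "p \<in> R" for a p
    proof -
      obtain f g n m where 1: "p = (f + n - m, g - scaleC \<i> n - scaleC \<i> m)" "(f, g) \<in> G" "(n, m) \<in> P"
        using RE[OF p] by blast
      have "(scaleC a f, scaleC a g) \<in> G" "(scaleC a n, scaleC a m) \<in> P"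
        using csubspaceD(5)[OF G(1) 1(2), of a] csubspaceD(5)[OF P 1(3), of a] by auto
      from RI[OF this] show ?thesis
        by (simp add: 1 scaleC_add_right scaleC_diff_right scaleC_scaleC mult.commute)
    qed
  qed
  \<comment> \<open>The eigenvalue equations of \<open>n\<close> and \<open>m\<close> for the
    adjoint, tested against elements of \<open>G\<close>.\<close>
  have defect1: "cinner n g = - (\<i> * cinner n f)" "cinner g n = \<i> * cinner f n"
    and defect2: "cinner m g = \<i> * cinner m f" "cinner g m = - (\<i> * cinner f m)"
    if "(f, g) \<in> G" "(n, m) \<in> P" for f g n m
  proof -
    have "n \<in> relation_defect G \<i>" "m \<in> relation_defect G (- \<i>)"
      using that(2) by (auto simp flip: P1 P2 intro: rev_image_eqI)
    then show *: "cinner n g = - (\<i> * cinner n f)" "cinner m g = \<i> * cinner m f"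
      using that(1) by (auto simp: relation_defect_def cinner_simps eq_neg_iff_add_eq_0)
    show "cinner g n = \<i> * cinner f n" "cinner g m = - (\<i> * cinner f m)"
      using arg_cong[OF *(1), of cnj] arg_cong[OF *(2), of cnj]
      by (simp_all flip: cinner_commute)
  qed
  have symR: "symmetric_relation R"
    unfolding symmetric_relation_def
  proof (intro allI impI)
    fix x y x' y'
    assume xy: "(x, y) \<in> R" "(x', y') \<in> R"
    obtain f g n m where 1: "(x, y) = (f + n - m, g - scaleC \<i> n - scaleC \<i> m)" "(f, g) \<in> G" "(n, m) \<in> P"
      using RE[OF xy(1)] by blast
    obtain f' g' n' m' where 2: "(x', y') = (f' + n' - m', g' - scaleC \<i> n' - scaleC \<i> m')"
        "(f', g') \<in> G" "(n', m') \<in> P"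
      using RE[OF xy(2)] by blast
    have "cinner g f' = cinner f g'"
      using sym 1 2 unfolding symmetric_relation_def by blast
    moreover have eqs: "x = f + n - m" "y = g - scaleC \<i> n - scaleC \<i> m"
        "x' = f' + n' - m'" "y' = g' - scaleC \<i> n' - scaleC \<i> m'"
      using 1(1) 2(1) by auto
    \<comment> \<open>All terms that pair \<open>G\<close> with \<open>P\<close>, or
      \<open>n\<close> with \<open>m'\<close> and \<open>m\<close> with \<open>n'\<close>, agree on
      both sides. What is left is a multiple of \<open>cinner n n' - cinner m m'\<close>, which
      vanishes since \<open>P\<close> is isometric.\<close>
    ultimately show "cinner y x' = cinner x y'"
      unfolding eqs using defect1[OF 1(2) 2(3)] defect1[OF 2(2) 1(3)] defect2[OF 1(2) 2(3)]
        defect2[OF 2(2) 1(3)] Piso[OF 1(3) 2(3)]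
      by (simp add: cinner_simps algebra_simps)
  qed
  have "fst ` G \<subseteq> fst ` R"
    using GR by blast
  then have denseR: "closure (fst ` R) = UNIV"
    using dense closure_mono by blast
  have onto1: "\<exists>x y. (x, y) \<in> R \<and> y - scaleC \<i> x = h" for h
  proof -
    obtain f g n where fgn: "(f, g) \<in> G" "n \<in> relation_defect G \<i>" "h = g - scaleC \<i> f + n"
      using relation_defect_decomposition[OF G sym, of \<i>] by blast
    \<comment> \<open>In \<open>y - scaleC \<i> x\<close> the two contributions of \<open>m\<close>
      cancel and those of \<open>k\<close> add up to \<open>- 2 \<i> k\<close>, which has to equal
      \<open>n\<close>.\<close>
    define k where "k = scaleC (\<i>/2) n"
    have "scaleC \<i> k + scaleC \<i> k = - n"
      by (simp add: k_def scaleC_scaleC scaleC_minus1 flip: scaleC_add_left)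
    then have k: "n = - (scaleC \<i> k + scaleC \<i> k)"
      by simp
    have "k \<in> fst ` P"
      unfolding P1 k_def by (rule csubspaceD(5)[OF csubspace_relation_defect fgn(2)])
    then obtain m where "(k, m) \<in> P"
      by auto
    have "g - scaleC \<i> k - scaleC \<i> m - scaleC \<i> (f + k - m) = h"
      unfolding fgn(3) k by (simp add: scaleC_diff_right scaleC_add_right)
    then show ?thesis
      using RI[OF fgn(1) \<open>(k, m) \<in> P\<close>] by blast
  qed
  have onto2: "\<exists>x y. (x, y) \<in> R \<and> y + scaleC \<i> x = h" for h
  proof -
    obtain f g m where fgm: "(f, g) \<in> G" "m \<in> relation_defect G (- \<i>)" "h = g - scaleC (- \<i>) f + m"
      using relation_defect_decomposition[OF G sym, of "- \<i>"] by blast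
    \<comment> \<open>With the opposite sign it is \<open>n\<close> that cancels, so
      \<open>k\<close> is now the second component of an element of \<open>P\<close>.\<close>
    define k where "k = scaleC (\<i>/2) m"
    have "scaleC \<i> k + scaleC \<i> k = - m"
      by (simp add: k_def scaleC_scaleC scaleC_minus1 flip: scaleC_add_left)
    then have k: "m = - (scaleC \<i> k + scaleC \<i> k)"
      by simp
    have "k \<in> snd ` P"
      unfolding P2 k_def by (rule csubspaceD(5)[OF csubspace_relation_defect fgm(2)])
    then obtain n where "(n, k) \<in> P"
      by auto
    have "g - scaleC \<i> n - scaleC \<i> k + scaleC \<i> (f + n - k) = h"
      unfolding fgm(3) k by (simp add: scaleC_diff_right scaleC_add_right scaleC_minus_left)
    then show ?thesis
      using RI[OF fgm(1) \<open>(n, k) \<in> P\<close>] by blast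
  qed
  obtain B where B: "self_adjoint_operator univ_space B" "Dom B = fst ` R"
    "\<And>x y. (x, y) \<in> R \<Longrightarrow> app B x = y"
    using self_adjoint_operator_of_relation[OF R symR denseR onto1 onto2] by blast
  have RJ: "(J x, - J y) \<in> R" if "(x, y) \<in> R" for x y
  proof -
    obtain f g n m where 1: "(x, y) = (f + n - m, g - scaleC \<i> n - scaleC \<i> m)" "(f, g) \<in> G" "(n, m) \<in> P"
      using RE[of "(x, y)"] \<open>(x, y) \<in> R\<close> by blast
    \<comment> \<open>By antilinearity \<open>J\<close> turns \<open>- scaleC \<i> n\<close> into
      \<open>scaleC \<i> (J n)\<close>, and the outer minus sign restores the shape required by
      \<open>R\<close>.\<close>
    show ?thesis
      using RI[OF GJ[OF 1(2)] PJ[OF 1(3)]] 1(1)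
      by (simp add: conjugation_univ_spaceD[OF J] scaleC_minus_left)
  qed
  have "imaginary_operator univ_space J B"
    unfolding imaginary_operator_def
  proof (intro conjI ballI)
    show "linear_operator univ_space B"
      using B(1) by (simp add: self_adjoint_operator_def)
    fix x assume "x \<in> Dom B"
    then obtain y where xy: "(x, y) \<in> R"
      by (auto simp: B(2))
    show "J x \<in> Dom B"
      unfolding B(2) using RJ[OF xy] by force
    show "app B (J x) = \<ominus>\<^bsub>univ_space\<^esub> J (app B x)"
      using B(3)[OF RJ[OF xy]] B(3)[OF xy] by simp
  qed
  then show ?thesis
    using that[OF B(1)] GR B(2,3) by (metis fst_conv image_eqI)
qed

section \<open>Orthonormal bases\<close>

definition orthonormal :: "'a::complex_hilbert_space set \<Rightarrow> bool" where
  "orthonormal B \<longleftrightarrow> (\<forall>x\<in>B. \<forall>y\<in>B. cinner x y = (if x = y then 1 else 0))"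

lemma orthonormal_subset: "orthonormal B \<Longrightarrow> C \<subseteq> B \<Longrightarrow> orthonormal C"
  unfolding orthonormal_def by blast

lemma orthonormal_basis_univ_space:
  "orthonormal_basis univ_space N B \<longleftrightarrow> orthonormal B \<and> closed_span univ_space B = N"
  using closed_span_superset by (auto simp: orthonormal_basis_def orthonormal_def)

lemma cinner_mult_commute: "cinner x y * cinner y x = of_real ((cmod (cinner x y))\<^sup>2)"
  for x :: "'a::complex_hilbert_space"
  by (metis cinner_commute complex_norm_square)

lemma norm_orthonormal: "orthonormal B \<Longrightarrow> e \<in> B \<Longrightarrow> norm e = 1"
  unfolding orthonormal_def using cinner_self[of e]
  by (metis norm_ge_zero of_real_eq_1_iff power2_eq_imp_eq one_power2 zero_le_one)

section \<open>Bessel's inequality and Parseval's identity\<close>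

text \<open>The Fourier sum \<open>p\<close> satisfies \<open>cinner x p = cinner p p\<close>, so
  \<open>(norm x)\<^sup>2\<close> exceeds the sum of squares by exactly
  \<open>(norm (x - p))\<^sup>2\<close>.\<close>

lemma bessel:
  assumes "finite F" "orthonormal F"
  shows "(\<Sum>e\<in>F. (cmod (cinner x e))\<^sup>2) \<le> (norm x)\<^sup>2"
proof -
  define p where "p = (\<Sum>e\<in>F. scaleC (cinner x e) e)"
  let ?s = "\<Sum>e\<in>F. (cmod (cinner x e))\<^sup>2"
  have ep: "cinner e p = cinner e x" if "e \<in> F" for e
  proof -
    have "cinner e p = (\<Sum>e'\<in>F. if e' = e then cinner e x else 0)"
      unfolding p_def cinner_sum_right
      using assms(2) that
      by (intro sum.cong) (auto simp: orthonormal_def cinner_scaleC_right simp flip: cinner_commute)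
    then show ?thesis
      using assms(1) that by simp
  qed
  have px: "cinner p x = of_real ?s" and pp: "cinner p p = of_real ?s"
    by (simp_all add: p_def cinner_sum_left cinner_scaleC_left cinner_mult_commute ep[unfolded p_def])
  have xp: "cinner x p = of_real ?s"
    using px by (metis cinner_commute complex_cnj_complex_of_real)
  have "cinner (x - p) (x - p) = of_real ((norm x)\<^sup>2 - ?s)"
    by (simp only: px pp xp cinner_self[of x] cinner_diff_left cinner_diff_right of_real_diff) simp
  then have "(norm (x - p))\<^sup>2 = (norm x)\<^sup>2 - ?s"
    unfolding cinner_self of_real_eq_iff .
  then show ?thesis
    by (metis diff_ge_0_iff_ge zero_le_power2)
qed

text \<open>The vectors that equal their finite Fourier sum form a closed subspace containing
  \<open>F\<close>, hence containing the closed span.\<close>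

lemma parseval_finite:
  assumes "finite F" "orthonormal F" "x \<in> closed_span univ_space F"
  shows "(norm x)\<^sup>2 = (\<Sum>e\<in>F. (cmod (cinner x e))\<^sup>2)"
proof -
  let ?S = "{x. x = (\<Sum>e\<in>F. scaleC (cinner x e) e)}"
  have "csubspace ?S"
    by (rule csubspaceI)
      (auto simp: cinner_simps scaleC_add_left sum.distrib scaleC_scaleC[symmetric]
        simp flip: linear_sum[OF bounded_linear.linear[OF bounded_linear_scaleC]])
  moreover have "closed ?S"
  proof -
    have "continuous_on UNIV (\<lambda>x. scaleC (cinner x e) e)" for e :: 'a
      unfolding scaleC_eq[of "cinner _ e"] by (intro continuous_intros)
    then show ?thesis
      by (intro closed_Collect_eq continuous_intros)
  qed
  moreover have "F \<subseteq> ?S"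
  proof
    fix x assume x: "x \<in> F"
    have "(\<Sum>e\<in>F. scaleC (cinner x e) e) = (\<Sum>e\<in>F. if e = x then x else 0)"
      using assms(2) x by (intro sum.cong) (auto simp: orthonormal_def scaleC_one)
    then show "x \<in> ?S"
      using assms(1) x by simp
  qed
  ultimately have "x = (\<Sum>e\<in>F. scaleC (cinner x e) e)"
    using closed_span_minimal assms(3) by blast
  then have "cinner x x = (\<Sum>e\<in>F. cinner x e * cinner e x)"
    by (metis (no_types, lifting) cinner_scaleC_left cinner_sum_left sum.cong)
  then have "complex_of_real ((norm x)\<^sup>2) = of_real (\<Sum>e\<in>F. (cmod (cinner x e))\<^sup>2)"
    unfolding cinner_mult_commute cinner_self by simp
  then show ?thesis
    by (simp only: of_real_eq_iff)
qed

section \<open>The cardinality of orthonormal bases\<close>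

text \<open>Double counting of the squares of \<open>cmod (cinner f e)\<close>: by Parseval over
  \<open>B\<close> they add up to \<open>card F\<close>, by Bessel over \<open>F\<close> to at most
  \<open>card B\<close>.\<close>

lemma card_le_of_finite_basis:
  assumes "finite B" "orthonormal B" "orthonormal F" "finite F" "F \<subseteq> closed_span univ_space B"
  shows "card F \<le> card B"
proof -
  have "real (card F) = (\<Sum>f\<in>F. (norm f)\<^sup>2)"
    using norm_orthonormal[OF assms(3)] by simp
  also have "\<dots> = (\<Sum>f\<in>F. \<Sum>e\<in>B. (cmod (cinner f e))\<^sup>2)"
    using assms by (intro sum.cong parseval_finite) auto
  also have "\<dots> = (\<Sum>e\<in>B. \<Sum>f\<in>F. (cmod (cinner e f))\<^sup>2)"
    by (subst sum.swap) (metis (no_types, lifting) cinner_commute complex_mod_cnj sum.cong)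
  also have "\<dots> \<le> (\<Sum>e\<in>B. (norm e)\<^sup>2)"
    using assms by (intro sum_mono bessel) auto
  also have "\<dots> = real (card B)"
    using norm_orthonormal[OF assms(2)] by simp
  finally show ?thesis
    by simp
qed

lemma finite_of_finite_basis:
  assumes "finite B" "orthonormal B" "orthonormal C" "C \<subseteq> closed_span univ_space B"
  shows "finite C"
proof (rule ccontr)
  assume "infinite C"
  then obtain F where "F \<subseteq> C" "finite F" "card F = Suc (card B)"
    using infinite_arbitrarily_large by blast
  moreover from this have "card F \<le> card B"
    using assms orthonormal_subset by (intro card_le_of_finite_basis) auto
  ultimately show False
    by simp
qed

text \<open>By Bessel the squared coefficients are summable, and a summable family has countable
  support.\<close>

lemma countable_nonorthogonal:
  assumes "orthonormal B"
  shows "countable {e\<in>B. cinner x e \<noteq> 0}"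
proof -
  have "(\<lambda>e. (cmod (cinner x e))\<^sup>2) summable_on B"
    using bessel[OF _ orthonormal_subset[OF assms]]
    by (intro nonneg_bdd_above_summable_on bdd_aboveI[of _ "(norm x)\<^sup>2"]) auto
  then have "countable {e\<in>B. (cmod (cinner x e))\<^sup>2 \<noteq> 0}"
    by (rule summable_countable_real)
  then show ?thesis
    by simp
qed

lemma closed_span_orth_0:
  assumes "x \<in> closed_span univ_space B" "\<And>e. e \<in> B \<Longrightarrow> cinner e x = 0"
  shows "x = 0"
proof -
  have "closed_span univ_space B \<subseteq> {y. \<forall>z\<in>{x}. cinner y z = 0}"
    using assms(2) by (intro closed_span_minimal csubspace_orth closed_orth) auto
  then have "cinner x x = 0"
    using assms(1) by blast
  then show ?thesis
    by simp
qed

text \<open>No \<open>c\<close> in \<open>C\<close> is orthogonal to all of \<open>B\<close>, and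
  each \<open>e\<close> in \<open>B\<close> meets only countably many \<open>c\<close>. So
  \<open>C\<close> is covered by countable sets indexed by the infinite set
  \<open>B\<close>.\<close>

lemma orthonormal_bases_ordLeq:
  assumes "infinite B" "orthonormal B" "orthonormal C" "C \<subseteq> closed_span univ_space B"
  shows "(card_of C, card_of B) \<in> ordLeq"
proof -
  have "C \<subseteq> (\<Union>e\<in>B. {c\<in>C. cinner e c \<noteq> 0})"
  proof
    fix c assume c: "c \<in> C"
    then have "c \<noteq> 0"
      using norm_orthonormal[OF assms(3)] by force
    then obtain e where "e \<in> B" "cinner e c \<noteq> 0"
      using closed_span_orth_0[of c B] c assms(4) by blast
    then show "c \<in> (\<Union>e\<in>B. {c\<in>C. cinner e c \<noteq> 0})"
      using c by blast
  qed
  then have "(card_of C, card_of (\<Union>e\<in>B. {c\<in>C. cinner e c \<noteq> 0})) \<in> ordLeq"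
    by (rule card_of_mono1)
  moreover have "(card_of (\<Union>e\<in>B. {c\<in>C. cinner e c \<noteq> 0}), card_of B) \<in> ordLeq"
  proof (rule card_of_UNION_ordLeq_infinite[OF assms(1)])
    show "(card_of B, card_of B) \<in> ordLeq"
      by (rule ordLeq_refl[OF card_of_Card_order])
    have "(card_of (UNIV :: nat set), card_of B) \<in> ordLeq"
      using assms(1) infinite_iff_card_of_nat by blast
    moreover have "(card_of {c\<in>C. cinner e c \<noteq> 0}, card_of (UNIV :: nat set)) \<in> ordLeq" for e
      using countable_nonorthogonal[OF assms(3), of e] unfolding countable_def
      by (auto simp flip: card_of_ordLeq)
    ultimately show "\<forall>e\<in>B. (card_of {c\<in>C. cinner e c \<noteq> 0}, card_of B) \<in> ordLeq"
      using ordLeq_transitive by blast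
  qed
  ultimately show ?thesis
    by (rule ordLeq_transitive)
qed

lemma orthonormal_bases_ordIso:
  assumes "orthonormal_basis univ_space N B" "orthonormal_basis univ_space N C"
  shows "(card_of B, card_of C) \<in> ordIso"
proof -
  have on: "orthonormal B" "orthonormal C"
    and sub: "C \<subseteq> closed_span univ_space B" "B \<subseteq> closed_span univ_space C"
    using assms closed_span_superset by (auto simp: orthonormal_basis_univ_space)
  show ?thesis
  proof (cases "finite B")
    case True
    then have "finite C"
      using finite_of_finite_basis on sub by blast
    with True have "card B = card C"
      using card_le_of_finite_basis on sub by (metis order_antisym)
    then show ?thesis
      using True \<open>finite C\<close> finite_same_card_bij card_of_ordIso by blast
  next
    case False
    then have "infinite C"
      using finite_of_finite_basis on sub by blast
    with False show ?thesis
      using orthonormal_bases_ordLeq on sub ordIso_iff_ordLeq by blast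
  qed
qed

text \<open>Lets any convenient basis replace the one chosen by \<open>SOME\<close>; below it is a
  basis fixed by the conjugation.\<close>

lemma hilbert_dim_univ_space:
  assumes "orthonormal_basis univ_space N B"
  shows "(hilbert_dim univ_space N, card_of B) \<in> ordIso"
  unfolding hilbert_dim_def
  using someI[of "orthonormal_basis univ_space N", OF assms] assms by (rule orthonormal_bases_ordIso)

section \<open>Orthonormal bases fixed by a conjugation\<close>

text \<open>The vector \<open>x + J x\<close> is fixed by \<open>J\<close>. If it vanishes, then
  \<open>J x = - x\<close> and \<open>scaleC \<i> x\<close> is fixed instead. Normalizing by a real
  factor keeps the vector fixed.\<close>

lemma real_unit_vector_exists:
  fixes N :: "'a::complex_hilbert_space set"
  assumes J: "conjugation univ_space J" and N: "csubspace N" "\<And>x. x \<in> N \<Longrightarrow> J x \<in> N"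
    and x: "x \<in> N" "x \<noteq> 0"
  obtains u where "u \<in> N" "J u = u" "norm u = 1"
proof -
  note Js = conjugation_univ_spaceD[OF J]
  obtain v where v: "v \<in> N" "J v = v" "v \<noteq> 0"
  proof (cases "x + J x = 0")
    case True
    then have "J x = - x"
      by (simp add: eq_neg_iff_add_eq_0 add.commute)
    moreover have "scaleC \<i> x \<noteq> 0"
      using x(2) norm_scaleC[of \<i> x] by force
    ultimately show ?thesis
      using that[of "scaleC \<i> x"] csubspaceD(5)[OF N(1)] x(1)
      by (simp add: Js scaleC_minus_left scaleC_minus_right)
  next
    case False
    then show ?thesis
      using that[of "x + J x"] csubspaceD(2)[OF N(1)] N(2) x(1) by (simp add: Js add.commute)
  qed
  show ?thesis
  proof (rule that)
    let ?u = "scaleC (of_real (1 / norm v)) v"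
    show "?u \<in> N"
      using csubspaceD(5)[OF N(1) v(1)] .
    show "J ?u = ?u"
      by (simp only: Js v(2) complex_cnj_complex_of_real)
    show "norm ?u = 1"
      using v(3) by (simp only: norm_scaleC norm_of_real) simp
  qed
qed

text \<open>Zorn's lemma gives a maximal orthonormal set \<open>B\<close> of fixed vectors in
  \<open>N\<close>. Its orthogonal complement in \<open>N\<close> is invariant under
  \<open>J\<close>, so if it were nonzero it would contain a fixed unit vector that could be added
  to \<open>B\<close>.\<close>

lemma real_orthonormal_basis_exists:
  fixes N :: "'a::complex_hilbert_space set"
  assumes J: "conjugation univ_space J"
    and N: "csubspace N" "closed N" and NJ: "\<And>x. x \<in> N \<Longrightarrow> J x \<in> N"
  obtains B where "orthonormal_basis univ_space N B" "\<And>e. e \<in> B \<Longrightarrow> J e = e"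
proof -
  define \<A> where "\<A> = {B. B \<subseteq> N \<and> orthonormal B \<and> (\<forall>e\<in>B. J e = e)}"
  have "\<exists>M\<in>\<A>. \<forall>X\<in>\<A>. M \<subseteq> X \<longrightarrow> X = M"
  proof (rule subset_Zorn')
    fix \<C> assume C: "subset.chain \<A> \<C>"
    then have sub: "\<C> \<subseteq> \<A>" and lin: "\<And>X Y. X \<in> \<C> \<Longrightarrow> Y \<in> \<C> \<Longrightarrow> X \<subseteq> Y \<or> Y \<subseteq> X"
      by (auto simp: subset_chain_def)
    have "orthonormal (\<Union>\<C>)"
      unfolding orthonormal_def
    proof (intro ballI)
      fix x y assume "x \<in> \<Union>\<C>" "y \<in> \<Union>\<C>"
      \<comment> \<open>Any two elements of the union already lie in a common member of the
        chain.\<close>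
      then obtain X where "X \<in> \<C>" "x \<in> X" "y \<in> X"
        using lin by (metis UnionE subsetD)
      then show "cinner x y = (if x = y then 1 else 0)"
        using sub unfolding \<A>_def orthonormal_def by blast
    qed
    then show "\<Union>\<C> \<in> \<A>"
      using sub by (auto simp: \<A>_def)
  qed
  then obtain B where B: "B \<in> \<A>" and max: "\<And>X. X \<in> \<A> \<Longrightarrow> B \<subseteq> X \<Longrightarrow> X = B"
    by blast
  have on: "orthonormal B" and BN: "B \<subseteq> N" and BJ: "\<And>e. e \<in> B \<Longrightarrow> J e = e"
    using B by (auto simp: \<A>_def)
  note Js = conjugation_univ_spaceD[OF J]
  let ?N' = "N \<inter> {x. \<forall>e\<in>B. cinner x e = 0}"
  have N': "csubspace ?N'"
    by (rule csubspaceI) (auto simp: csubspaceD[OF N(1)] cinner_simps)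
  have N'J: "J x \<in> ?N'" if "x \<in> ?N'" for x
  proof -
    have "cinner (J x) e = 0" if "e \<in> B" for e
      using Js(4)[of x e] BJ[OF that] \<open>x \<in> ?N'\<close> that cinner_eq_0_commute[of e x] by simp
    then show ?thesis
      using NJ that by blast
  qed
  have N'0: "x = 0" if "x \<in> ?N'" for x
  proof (rule ccontr)
    assume "x \<noteq> 0"
    then obtain u where u: "u \<in> ?N'" "J u = u" "norm u = 1"
      using real_unit_vector_exists[OF J N' N'J \<open>x \<in> ?N'\<close>] \<open>x \<noteq> 0\<close> by blast
    have "cinner u u = 1" "u \<notin> B"
      using u on by (auto simp: cinner_self orthonormal_def)
    then have "insert u B \<in> \<A>"
      using u on BN BJ cinner_eq_0_commute[of _ u] by (auto simp: \<A>_def orthonormal_def)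
    then show False
      using max \<open>u \<notin> B\<close> by blast
  qed
  have "N \<subseteq> closed_span univ_space B"
  proof
    \<comment> \<open>The remainder of \<open>x\<close> after projection onto the closed span of
      \<open>B\<close> lies in \<open>N\<close> and is orthogonal to \<open>B\<close>, hence is
      0.\<close>
    fix x assume x: "x \<in> N"
    obtain m where m: "m \<in> closed_span univ_space B"
      "\<And>y. y \<in> closed_span univ_space B \<Longrightarrow> cinner (x - m) y = 0"
      using orthogonal_decomposition[OF csubspace_closed_span closed_closed_span] by blast
    have "m \<in> N"
      using m(1) closed_span_minimal[OF N BN] by blast
    then have "x - m \<in> ?N'"
      using m(2) closed_span_superset csubspaceD(3)[OF N(1) x] by blast
    then show "x \<in> closed_span univ_space B"
      using N'0 m(1) by fastforce
  qed
  then have "orthonormal_basis univ_space N B"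
    using on closed_span_minimal[OF N BN] by (auto simp: orthonormal_basis_univ_space)
  then show ?thesis
    using that BJ by blast
qed

text \<open>The graph of the unitary operator is the closed span of the pairs \<open>(e, \<phi> e)\<close>: a property of
  all its elements need only be checked on these generators.\<close>

lemma real_unitary_graph_exists:
  fixes J :: "'a::complex_hilbert_space \<Rightarrow> 'a"
  assumes J: "conjugation univ_space J"
    and N: "csubspace N" "closed N" "\<And>x. x \<in> N \<Longrightarrow> J x \<in> N"
    and M: "csubspace M" "closed M" "\<And>x. x \<in> M \<Longrightarrow> J x \<in> M"
    and dim: "(hilbert_dim univ_space N, hilbert_dim univ_space M) \<in> ordIso"
  obtains P where "csubspace P" "fst ` P = N" "snd ` P = M"
    "\<And>n m n' m'. (n, m) \<in> P \<Longrightarrow> (n', m') \<in> P \<Longrightarrow> cinner n n' = cinner m m'"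
    "\<And>n m. (n, m) \<in> P \<Longrightarrow> (J n, J m) \<in> P"
proof -
  obtain B where B: "orthonormal_basis univ_space N B" "\<And>e. e \<in> B \<Longrightarrow> J e = e"
    using real_orthonormal_basis_exists[OF J N] by blast
  obtain C where C: "orthonormal_basis univ_space M C" "\<And>e. e \<in> C \<Longrightarrow> J e = e"
    using real_orthonormal_basis_exists[OF J M] by blast
  have "(card_of B, card_of C) \<in> ordIso"
    using hilbert_dim_univ_space[OF B(1)] hilbert_dim_univ_space[OF C(1)] dim
    by (meson ordIso_symmetric ordIso_transitive)
  then obtain \<phi> where \<phi>: "bij_betw \<phi> B C"
    using card_of_ordIso by blast
  have on: "orthonormal B" "orthonormal C" and spanB: "closed_span univ_space B = N"
    and spanC: "closed_span univ_space C = M"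
    using B(1) C(1) by (auto simp: orthonormal_basis_univ_space)
  have \<phi>_in: "\<phi> e \<in> C" if "e \<in> B" for e
    using \<phi> that by (auto simp: bij_betw_def)
  let ?gen = "(\<lambda>e. (e, \<phi> e)) ` B"
  define P where "P = closed_span univ_space ?gen"
  have P: "csubspace P" "closed P"
    unfolding P_def by (rule csubspace_closed_span closed_closed_span)+
  have gen: "(e, \<phi> e) \<in> P" if "e \<in> B" for e
    unfolding P_def by (rule subsetD[OF closed_span_superset]) (rule imageI[OF that])
  have P_sub: "P \<subseteq> S" if "csubspace S" "closed S" "\<And>e. e \<in> B \<Longrightarrow> (e, \<phi> e) \<in> S" for S
    unfolding P_def by (rule closed_span_minimal[OF that(1,2) image_subsetI]) (rule that(3))
  \<comment> \<open>The isometry property is extended one argument at a time: first against the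
    generators, then against all of \<open>P\<close>.\<close>
  have iso1: "cinner (fst p) e = cinner (snd p) (\<phi> e)" if "p \<in> P" "e \<in> B" for p e
  proof -
    have "P \<subseteq> {p. cinner (fst p) e = cinner (snd p) (\<phi> e)}"
    proof (rule P_sub)
      show "closed {p. cinner (fst p) e = cinner (snd p) (\<phi> e)}"
        by (intro closed_Collect_eq continuous_intros)
      show "csubspace {p. cinner (fst p) e = cinner (snd p) (\<phi> e)}"
        by (rule csubspaceI) (auto simp: cinner_simps scaleC_prod_def)
      show "(e', \<phi> e') \<in> {p. cinner (fst p) e = cinner (snd p) (\<phi> e)}" if "e' \<in> B" for e'
        using on \<phi>_in \<phi> that \<open>e \<in> B\<close> by (auto simp: orthonormal_def bij_betw_def inj_on_def)
    qed
    with that show ?thesis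
      by blast
  qed
  have iso: "cinner (fst p) (fst q) = cinner (snd p) (snd q)" if "p \<in> P" "q \<in> P" for p q
  proof -
    have "P \<subseteq> {q. cinner (fst p) (fst q) = cinner (snd p) (snd q)}"
    proof (rule P_sub)
      show "closed {q. cinner (fst p) (fst q) = cinner (snd p) (snd q)}"
        by (intro closed_Collect_eq continuous_intros)
      show "csubspace {q. cinner (fst p) (fst q) = cinner (snd p) (snd q)}"
        by (rule csubspaceI) (auto simp: cinner_simps scaleC_prod_def)
    qed (simp add: iso1 that(1))
    with that show ?thesis
      by blast
  qed
  have norm_P: "norm (fst p) = norm (snd p)" if "p \<in> P" for p
    using iso[OF that that] unfolding cinner_self
    by (metis norm_ge_zero of_real_eq_iff power2_eq_imp_eq)
  \<comment> \<open>Both components of \<open>p\<close> have the same norm, so both projections are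
    bounded below on \<open>P\<close> and have closed images; these contain the bases
    \<open>B\<close> and \<open>C\<close>.\<close>
  have norm_le: "(1/2) * norm p \<le> norm (fst p)" "(1/2) * norm p \<le> norm (snd p)" if "p \<in> P" for p
    using norm_P[OF that] norm_Pair_le[of "fst p" "snd p"] by simp_all
  have "fst ` P \<subseteq> N" "snd ` P \<subseteq> M"
  proof -
    have "P \<subseteq> N \<times> M"
      using closed_span_superset[of B] \<phi>_in closed_span_superset[of C] unfolding spanB spanC
      by (intro P_sub closed_Times N M csubspaceI)
        (auto simp: csubspaceD[OF N(1)] csubspaceD[OF M(1)] zero_prod_def)
    then show "fst ` P \<subseteq> N" "snd ` P \<subseteq> M"
      by auto
  qed
  moreover have "N \<subseteq> fst ` P"
    unfolding spanB[symmetric]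
  proof (rule closed_span_minimal)
    show "csubspace (fst ` P)"
      using P(1) by (rule csubspace_linear_image) (auto simp: bounded_linear_fst scaleC_prod_def)
    show "closed (fst ` P)"
      using P bounded_linear_fst _ norm_le(1) by (rule closed_bounded_below_image) simp
    show "B \<subseteq> fst ` P"
      using gen by force
  qed
  moreover have "M \<subseteq> snd ` P"
    unfolding spanC[symmetric]
  proof (rule closed_span_minimal)
    show "csubspace (snd ` P)"
      using P(1) by (rule csubspace_linear_image) (auto simp: bounded_linear_snd scaleC_prod_def)
    show "closed (snd ` P)"
      using P bounded_linear_snd _ norm_le(2) by (rule closed_bounded_below_image) simp
    show "C \<subseteq> snd ` P"
      using gen \<phi> by (force simp: bij_betw_def)
  qed
  moreover have "(J n, J m) \<in> P" if "(n, m) \<in> P" for n m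
  proof -
    note Js = conjugation_univ_spaceD[OF J]
    have "P \<subseteq> {p. (J (fst p), J (snd p)) \<in> P}"
    proof (rule P_sub)
      \<comment> \<open>Although \<open>J\<close> is only antilinear, the preimage of a complex
        subspace is one, as \<open>cnj a\<close> runs through all scalars with
        \<open>a\<close>.\<close>
      show "csubspace {p. (J (fst p), J (snd p)) \<in> P}"
        using csubspaceD(1)[OF P(1)] csubspaceD(2)[OF P(1)] csubspaceD(5)[OF P(1)]
        by (intro csubspaceI) (force simp: Js zero_prod_def scaleC_prod_def)+
      have "continuous_on UNIV (\<lambda>p. (J (fst p), J (snd p)))"
        by (intro continuous_intros bounded_linear.continuous_on[OF bounded_linear_conjugation[OF J]])
      then show "closed {p. (J (fst p), J (snd p)) \<in> P}"
        using closed_vimage[OF P(2)] by (simp add: vimage_def)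
    qed (simp add: gen B(2) C(2) \<phi>_in)
    with that show ?thesis
      by auto
  qed
  ultimately show ?thesis
    using that[OF P(1)] iso by fastforce
qed

section \<open>Self-adjoint extensions\<close>

definition graph :: "'a operator \<Rightarrow> ('a \<times> 'a) set" where
  "graph A = (\<lambda>f. (f, app A f)) ` Dom A"

lemma mem_graph_iff: "(x, y) \<in> graph A \<longleftrightarrow> x \<in> Dom A \<and> y = app A x"
  by (auto simp: graph_def)

lemma csubspace_graph:
  assumes "linear_operator univ_space A"
  shows "csubspace (graph A)"
proof -
  have D: "csubspace (Dom A)"
    using assms by (simp add: linear_operator_def submodule_univ_space_iff)
  have add: "app A (f + g) = app A f + app A g" if "f \<in> Dom A" "g \<in> Dom A" for f g
    using assms that by (simp add: linear_operator_def)
  have sc: "app A (scaleC a f) = scaleC a (app A f)" if "f \<in> Dom A" for a f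
    using assms that by (simp add: linear_operator_def)
  have "app A 0 = 0"
    using sc[OF csubspaceD(1)[OF D], of 0] by simp
  then show ?thesis
    using csubspaceD(1,2,5)[OF D] add sc
    by (intro csubspaceI) (auto simp: mem_graph_iff zero_prod_def)
qed

lemma closed_graph:
  assumes "closed_operator univ_space A"
  shows "closed (graph A)"
  using assms by (simp add: closed_operator_def graph_def euclidean_product_topology)

lemma symmetric_relation_graph:
  assumes "symmetric_operator univ_space A"
  shows "symmetric_relation (graph A)"
  using assms by (simp add: symmetric_operator_def symmetric_relation_def mem_graph_iff)

lemma defect_subspace_eq_relation_defect:
  "defect_subspace univ_space A z = relation_defect (graph A) z"
  by (auto simp: defect_subspace_def orth_complement_def relation_defect_def mem_graph_iff)

text \<open>As \<open>z\<close> is purely imaginary, \<open>J (y - scaleC z x)\<close> is the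
  negative of the value of \<open>G - z\<close> at \<open>(J x, - J y)\<close>. So \<open>J\<close>
  preserves the range of \<open>G - z\<close>, and with it the orthogonal complement.\<close>

lemma relation_defect_conjugation:
  fixes G :: "('a::complex_hilbert_space \<times> 'a) set"
  assumes J: "conjugation univ_space J" and GJ: "\<And>x y. (x, y) \<in> G \<Longrightarrow> (J x, - J y) \<in> G"
    and z: "cnj z = - z" and w: "w \<in> relation_defect G z"
  shows "J w \<in> relation_defect G z"
  unfolding relation_defect_def
proof (intro CollectI allI impI)
  note Js = conjugation_univ_spaceD[OF J]
  fix x y
  assume "(x, y) \<in> G"
  then have "cinner w (- J y - scaleC z (J x)) = 0"
    using w GJ by (simp add: relation_defect_def)
  then have "cinner w (J (y - scaleC z x)) = 0"
    by (simp add: Js z scaleC_minus_left cinner_simps eq_neg_iff_add_eq_0 add.commute)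
  then show "cinner (J w) (y - scaleC z x) = 0"
    using Js(4)[of w "J (y - scaleC z x)"] Js(3) cinner_eq_0_commute by metis
qed

text \<open>The graph of \<open>A \<oplus> (-A)\<close>. Its defect subspaces are \<open>N\<^sub>i \<times> N\<^sub>-\<^sub>i\<close> and \<open>N\<^sub>-\<^sub>i \<times> N\<^sub>i\<close>, so that the swap
  is a unitary operator between them.\<close>

definition double_relation :: "('a::complex_hilbert_space \<times> 'a) set \<Rightarrow> (('a \<times> 'a) \<times> ('a \<times> 'a)) set"
  where "double_relation G = {((f, g), (h, k)) | f g h k. (f, h) \<in> G \<and> (g, - k) \<in> G}"

lemma mem_double_relation_iff [simp]:
  "((f, g), (h, k)) \<in> double_relation G \<longleftrightarrow> (f, h) \<in> G \<and> (g, - k) \<in> G"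
  by (simp add: double_relation_def)

lemma csubspace_double_relation:
  assumes "csubspace G"
  shows "csubspace (double_relation G)"
proof (rule csubspaceI)
  show "0 \<in> double_relation G"
    using csubspaceD(1)[OF assms] by (simp add: zero_prod_def)
  show "p + q \<in> double_relation G" if "p \<in> double_relation G" "q \<in> double_relation G" for p q
    using that csubspaceD(2)[OF assms] by (fastforce simp: double_relation_def)
  show "scaleC a p \<in> double_relation G" if "p \<in> double_relation G" for a p
    using that csubspaceD(5)[OF assms, of _ a]
    by (fastforce simp: double_relation_def simp flip: scaleC_minus_right)
qed

lemma closed_double_relation:
  assumes "closed G"
  shows "closed (double_relation G)"
proof -
  have "double_relation G = (\<lambda>p. (fst (fst p), fst (snd p))) -` G
      \<inter> (\<lambda>p. (snd (fst p), - snd (snd p))) -` G"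
    by (auto simp: double_relation_def)
  then show ?thesis
    using assms by (auto intro!: closed_Int closed_vimage continuous_intros)
qed

lemma symmetric_double_relation:
  assumes "symmetric_relation G"
  shows "symmetric_relation (double_relation G)"
proof -
  have *: "cinner y x' = cinner x y'" if "(x, y) \<in> G" "(x', y') \<in> G" for x y x' y'
    using assms that unfolding symmetric_relation_def by blast
  have **: "cinner k g' = cinner g k'" if "(g, - k) \<in> G" "(g', - k') \<in> G" for g k g' k'
    using *[OF that] by (simp add: cinner_simps)
  show ?thesis
    unfolding symmetric_relation_def
    \<comment> \<open>The scalar product splits into the two summands, where the symmetry of
      \<open>G\<close> and of its negative apply separately.\<close>
    by (clarsimp; rule arg_cong2[of _ _ _ _ "(+)"]; rule * **; assumption)
qed

lemma fst_double_relation: "fst ` double_relation G = fst ` G \<times> fst ` G"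
proof (intro subset_antisym subsetI)
  fix p
  assume "p \<in> fst ` G \<times> fst ` G"
  then obtain f g h k where "p = (f, g)" "(f, h) \<in> G" "(g, k) \<in> G"
    by auto
  then have "(p, (h, - k)) \<in> double_relation G"
    by simp
  then show "p \<in> fst ` double_relation G"
    by force
qed (force simp: double_relation_def)

text \<open>Taking \<open>(0, 0)\<close> in one summand decouples the two conditions. In the second
  summand, \<open>k - scaleC z g\<close> is the negative of \<open>- k - scaleC (- z) g\<close>,
  which is why \<open>z\<close> changes sign there.\<close>

lemma relation_defect_double_relation:
  assumes "csubspace G"
  shows "relation_defect (double_relation G) z = relation_defect G z \<times> relation_defect G (- z)"
proof (intro subset_antisym subsetI)
  have 0: "(0, 0) \<in> G"
    using csubspaceD(1)[OF assms] by (simp add: zero_prod_def)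
  fix p
  assume p: "p \<in> relation_defect (double_relation G) z"
  obtain v w where vw: "p = (v, w)"
    by fastforce
  have *: "cinner v (h - scaleC z f) + cinner w (k - scaleC z g) = 0"
    if "(f, h) \<in> G" "(g, - k) \<in> G" for f g h k
  proof -
    have "((f, g), (h, k)) \<in> double_relation G"
      using that by simp
    then have "cinner p ((h, k) - scaleC z (f, g)) = 0"
      using p unfolding relation_defect_def by blast
    then show ?thesis
      by (simp add: vw)
  qed
  have "v \<in> relation_defect G z"
    using *[of _ _ 0 0] 0 by (simp add: relation_defect_def)
  moreover have "cinner w (k - scaleC (- z) g) = 0" if "(g, k) \<in> G" for g k
  proof -
    have "cinner w (- k - scaleC z g) = 0"
      using *[of 0 0 g "- k"] 0 that by simp
    moreover have "k - scaleC (- z) g = - (- k - scaleC z g)"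
      by (simp add: scaleC_minus_left)
    ultimately show ?thesis
      by (simp only: cinner_minus_right neg_equal_0_iff_equal)
  qed
  ultimately show "p \<in> relation_defect G z \<times> relation_defect G (- z)"
    by (simp add: vw relation_defect_def)
next
  fix p
  assume "p \<in> relation_defect G z \<times> relation_defect G (- z)"
  then obtain v w where p: "p = (v, w)" and v: "v \<in> relation_defect G z"
    and w: "w \<in> relation_defect G (- z)"
    by blast
  show "p \<in> relation_defect (double_relation G) z"
    unfolding relation_defect_def
  proof (intro CollectI allI impI)
    fix x y
    assume "(x, y) \<in> double_relation G"
    then obtain f g h k where xy: "x = (f, g)" "y = (h, k)" "(f, h) \<in> G" "(g, - k) \<in> G"
      by (auto simp: double_relation_def)
    have "cinner v (h - scaleC z f) = 0" "cinner w (- k - scaleC (- z) g) = 0"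
      using v w xy(3,4) by (simp_all add: relation_defect_def)
    then show "cinner p (y - scaleC z x) = 0"
      by (simp add: p xy cinner_simps)
  qed
qed

lemma conjugation_double:
  assumes "conjugation univ_space J"
  shows "conjugation univ_space (\<lambda>p. (J (fst p), J (snd p)))"
  using conjugation_univ_spaceD[OF assms] by (simp add: conjugation_def cinner_prod_def scaleC_prod_def)

lemma isometric_embedding_Pair_0:
  "isometric_embedding univ_space univ_space (\<lambda>h::'a::complex_hilbert_space. (h, 0::'a))"
proof -
  have "range (\<lambda>h::'a. (h, 0::'a)) = UNIV \<times> {0}"
    by auto
  then have "closed (range (\<lambda>h::'a. (h, 0::'a)))"
    by (simp add: closed_Times)
  then show ?thesis
    by (simp add: isometric_embedding_def)
qed

section \<open>The extension in the doubled space\<close>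

text \<open>The swap of the summands supplies the unitary operator for von Neumann's extension,
  whatever the sizes of the two defect subspaces, and it commutes with \<open>J\<close> acting on
  both components.\<close>

lemma self_adjoint_extension_double:
  fixes G :: "('a::complex_hilbert_space \<times> 'a) set"
  assumes G: "csubspace G" "closed G" and sym: "symmetric_relation G"
    and dense: "closure (fst ` G) = UNIV"
    and J: "conjugation univ_space J" and GJ: "\<And>x y. (x, y) \<in> G \<Longrightarrow> (J x, - J y) \<in> G"
  obtains B where "self_adjoint_operator univ_space B"
    "imaginary_operator univ_space (\<lambda>p. (J (fst p), J (snd p))) B"
    "\<And>x y. (x, y) \<in> G \<Longrightarrow> (x, 0) \<in> Dom B \<and> app B (x, 0) = (y, 0)"
proof -
  let ?J = "\<lambda>p. (J (fst p), J (snd p))"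
  let ?N = "relation_defect G \<i>" and ?M = "relation_defect G (- \<i>)"
  \<comment> \<open>The graph of the swap, restricted to the defect subspace
    \<open>?N \<times> ?M\<close> of the doubled relation.\<close>
  define P where "P = {((n, m), (m, n)) | n m. n \<in> ?N \<and> m \<in> ?M}"
  have NJ: "J w \<in> ?N" if "w \<in> ?N" for w
    by (rule relation_defect_conjugation[OF J GJ _ that]) simp_all
  have MJ: "J w \<in> ?M" if "w \<in> ?M" for w
    by (rule relation_defect_conjugation[OF J GJ _ that]) simp_all
  have G0: "(0, 0) \<in> G"
    using csubspaceD(1)[OF G(1)] by (simp add: zero_prod_def)
  show ?thesis
  proof (rule von_neumann_extension[of "double_relation G" ?J P])
    show "csubspace (double_relation G)" "closed (double_relation G)"
      "symmetric_relation (double_relation G)"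
      by (intro csubspace_double_relation closed_double_relation symmetric_double_relation G sym)+
    show "closure (fst ` double_relation G) = UNIV"
      by (simp add: fst_double_relation closure_Times dense)
    show "conjugation univ_space ?J"
      by (rule conjugation_double[OF J])
    show "(?J x, - ?J y) \<in> double_relation G" if "(x, y) \<in> double_relation G" for x y
      using that GJ[of "fst x" "fst y"] GJ[of "snd x" "- snd y"]
      by (cases x; cases y) (simp add: conjugation_univ_spaceD[OF J])
    show "csubspace P"
    proof (rule csubspaceI)
      note N = csubspaceD[OF csubspace_relation_defect]
      show "0 \<in> P"
        by (simp add: P_def zero_prod_def N(1))
      show "p + q \<in> P" if "p \<in> P" "q \<in> P" for p q
        using that by (auto simp: P_def N(2))
      show "scaleC a p \<in> P" if "p \<in> P" for a p
        using that by (auto simp: P_def N(5))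
    qed
    show "fst ` P = relation_defect (double_relation G) \<i>"
      unfolding relation_defect_double_relation[OF G(1)] by (force simp: P_def)
    show "snd ` P = relation_defect (double_relation G) (- \<i>)"
      unfolding relation_defect_double_relation[OF G(1)] by (force simp: P_def)
    show "cinner n n' = cinner m m'" if "(n, m) \<in> P" "(n', m') \<in> P" for n m n' m'
      using that by (auto simp: P_def)
    show "(?J n, ?J m) \<in> P" if "(n, m) \<in> P" for n m
      using that NJ MJ by (auto simp: P_def)
    fix B
    assume B: "self_adjoint_operator univ_space B" "imaginary_operator univ_space ?J B"
      "\<And>x y. (x, y) \<in> double_relation G \<Longrightarrow> x \<in> Dom B \<and> app B x = y"
    show thesis
    proof (rule that[OF B(1,2)])
      show "(x, 0) \<in> Dom B \<and> app B (x, 0) = (y, 0)" if "(x, y) \<in> G" for x y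
        \<comment> \<open>An element of \<open>G\<close> in the first summand is paired with
          \<open>(0, 0)\<close> in the second.\<close>
        using that G0 by (intro B(3)) simp
    qed
  qed
qed

theorem theorem2:
  fixes J :: "'a::complex_hilbert_space \<Rightarrow> 'a"
    and A :: "'a operator"
  assumes "conjugation univ_space J"
    and "closed_operator univ_space A"
    and "symmetric_operator univ_space A"
    and "imaginary_operator univ_space J A"
    and "densely_defined univ_space A"
  shows "(\<exists>(H' :: ('a \<times> 'a) hspace) V J' A'.
            hilbert_space H' \<and> isometric_embedding univ_space H' V \<and>
            conjugation H' J' \<and> (\<forall>h. J' (V h) = V (J h)) \<and>
            self_adjoint_operator H' A' \<and> imaginary_operator H' J' A' \<and>
            extends_along V A' A) \<and>
         (equal_defect_numbers univ_space A \<longrightarrow>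
           (\<exists>A'. self_adjoint_operator univ_space A' \<and> imaginary_operator univ_space J A' \<and>
                 extends A' A))"
proof (intro conjI impI)
  note J = assms(1)
  let ?G = "graph A"
  have G: "csubspace ?G" "closed ?G"
    using assms(2) closed_graph csubspace_graph by (auto simp: closed_operator_def)
  note sym = symmetric_relation_graph[OF assms(3)]
  have "fst ` ?G = Dom A"
    by (force simp: graph_def)
  then have dense: "closure (fst ` ?G) = UNIV"
    using assms(5) by (simp add: densely_defined_def)
  have GJ: "(J x, - J y) \<in> ?G" if "(x, y) \<in> ?G" for x y
    using assms(4) that by (auto simp: imaginary_operator_def mem_graph_iff)
  show "\<exists>(H' :: ('a \<times> 'a) hspace) V J' A'.
            hilbert_space H' \<and> isometric_embedding univ_space H' V \<and>
            conjugation H' J' \<and> (\<forall>h. J' (V h) = V (J h)) \<and>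
            self_adjoint_operator H' A' \<and> imaginary_operator H' J' A' \<and>
            extends_along V A' A"
  proof -
    let ?J = "\<lambda>p. (J (fst p), J (snd p))"
    obtain B where B: "self_adjoint_operator univ_space B" "imaginary_operator univ_space ?J B"
      "\<And>x y. (x, y) \<in> ?G \<Longrightarrow> (x, 0) \<in> Dom B \<and> app B (x, 0) = (y, 0)"
      using self_adjoint_extension_double[OF G sym dense J GJ] by blast
    have "extends_along (\<lambda>h. (h, 0)) B A"
      using B(3) by (auto simp: extends_along_def mem_graph_iff)
    moreover have "\<forall>h. ?J (h, 0) = (J h, 0)"
      by (simp add: conjugation_univ_spaceD[OF J])
    ultimately show ?thesis
      using hilbert_space_univ_space isometric_embedding_Pair_0 conjugation_double[OF J] B(1,2)
      by (intro exI[of _ univ_space] exI[of _ "\<lambda>h. (h, 0)"] exI[of _ ?J] exI[of _ B] conjI)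
  qed
  show "\<exists>A'. self_adjoint_operator univ_space A' \<and> imaginary_operator univ_space J A' \<and> extends A' A"
    if "equal_defect_numbers univ_space A"
  proof -
    have dim: "(hilbert_dim univ_space (relation_defect ?G \<i>),
        hilbert_dim univ_space (relation_defect ?G (- \<i>))) \<in> ordIso"
      using that by (simp add: equal_defect_numbers_def defect_number_def
          defect_subspace_eq_relation_defect)
    have NJ: "J w \<in> relation_defect ?G \<i>" if "w \<in> relation_defect ?G \<i>" for w
      by (rule relation_defect_conjugation[OF J GJ _ that]) simp_all
    have MJ: "J w \<in> relation_defect ?G (- \<i>)" if "w \<in> relation_defect ?G (- \<i>)" for w
      by (rule relation_defect_conjugation[OF J GJ _ that]) simp_all
    obtain P where P: "csubspace P" "fst ` P = relation_defect ?G \<i>"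
      "snd ` P = relation_defect ?G (- \<i>)"
      "\<And>n m n' m'. (n, m) \<in> P \<Longrightarrow> (n', m') \<in> P \<Longrightarrow> cinner n n' = cinner m m'"
      "\<And>n m. (n, m) \<in> P \<Longrightarrow> (J n, J m) \<in> P"
      \<comment> \<open>Equal defect numbers enter only here: they match the \<open>J\<close>-fixed
        bases of the two defect subspaces.\<close>
      using real_unitary_graph_exists[OF J csubspace_relation_defect closed_relation_defect NJ
          csubspace_relation_defect closed_relation_defect MJ dim] by blast
    obtain B where B: "self_adjoint_operator univ_space B" "imaginary_operator univ_space J B"
      "\<And>x y. (x, y) \<in> ?G \<Longrightarrow> x \<in> Dom B \<and> app B x = y"
      using von_neumann_extension[OF G sym dense J GJ P] by blast
    have "extends B A"
      using B(3) by (auto simp: extends_def mem_graph_iff)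
    with B(1,2) show ?thesis
      by blast
  qed
qed

end
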